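(* Let $n\ge 2$, let $\Gamma$ be a compact $C^1$-hypersurface in $\mathbb{R}^n$ satisfying the irrational direction dense condition (IDDC), and let $g\in L^\infty(\Gamma\times\mathbb{T}^n)$ be such that $\{g(z,\cdot)\}_{z\in\Gamma}$ is an equicontinuous family of functions on $\mathbb{T}^n$. Then $$\lim_{\varepsilon\to 0}\int_\Gamma g\left(x,\frac{x}{\varepsilon}\right)d\sigma_x=\int_\Gamma\int_{\mathbb{T}^n} g(x,y)\,dy\,d\sigma_x .$$
   Context: $\mathbb{T}^n$ is the $n$-dimensional unit torus; functions on $\mathbb{T}^n$ are identified with $\mathbb{Z}^n$-periodic functions on $\mathbb{R}^n$, so $g(x,x/\varepsilon)$ makes sense ($g$ is a bounded measurable function that is continuous in its second argument). $\sigma$ is the surface measure on $\Gamma$ and $\nu:\Gamma\to\mathbb{S}^{n-1}$ is the unit normal mapping. A vector $\nu\in\mathbb{S}^{n-1}$ is called a rational direction if $\nu=\alpha k$ for some $\alpha\in\mathbb{R}$ and $k\in\mathbb{Z}^n$; otherwise it is an irrational direction. $\Gamma$ satisfies IDDC (irrational direction dense condition) if $\sigma(\{z\in\Gamma:\nu(z)\text{ is rational}\})=0$. *)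

theory Defs
  imports "HOL-Analysis.Analysis"
begin

section \<open>Hausdorff measure\<close>

text \<open>The constant \<^term>\<open>unit_ball_vol (real d) / 2 ^ d\<close> is the usual normalisation,
  under which \<open>d\<close>-dimensional Hausdorff measure is \<open>d\<close>-dimensional area on
  \<open>C\<^sup>1\<close> submanifolds.  \<^const>\<open>diameter\<close> is meaningful for bounded sets only, hence the
  boundedness requirement on coverings below; the case distinction keeps the empty set
  weightless also for \<open>d = 0\<close>.\<close>

definition hausdorff_gauge :: "nat \<Rightarrow> 'a::metric_space set \<Rightarrow> ennreal" where
  "hausdorff_gauge d C =
    (if C = {} then 0 else ennreal (unit_ball_vol (real d) * (diameter C / 2) ^ d))"

definition hausdorff_content :: "nat \<Rightarrow> real \<Rightarrow> 'a::metric_space set \<Rightarrow> ennreal" where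
  "hausdorff_content d \<delta> A =
    (INF C \<in> {C :: nat \<Rightarrow> 'a set. A \<subseteq> (\<Union>i. C i) \<and> (\<forall>i. bounded (C i) \<and> diameter (C i) \<le> \<delta>)}.
       \<Sum>i. hausdorff_gauge d (C i))"

definition hausdorff_outer :: "nat \<Rightarrow> 'a::metric_space set \<Rightarrow> ennreal" where
  "hausdorff_outer d A = (SUP \<delta> \<in> {0<..}. hausdorff_content d \<delta> A)"

definition hausdorff_measure :: "nat \<Rightarrow> 'a::metric_space measure" where
  "hausdorff_measure d = measure_of UNIV (sets borel) (hausdorff_outer d)"

text \<open>\<^const>\<open>measure_of\<close> yields the zero measure when its last argument is not a measure; the
  results up to \<open>emeasure_hausdorff_measure\<close> show (by Caratheodory's criterion for metric outer
  measures) that this does not happen here.\<close>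

lemma hausdorff_gauge_empty [simp]: "hausdorff_gauge d {} = 0"
  by (simp add: hausdorff_gauge_def)

lemma hausdorff_content_empty [simp]:
  assumes "0 < \<delta>" shows "hausdorff_content d \<delta> {} = 0"
proof -
  have "hausdorff_content d \<delta> {} \<le> (\<Sum>i::nat. hausdorff_gauge d ({}::'a set))"
    unfolding hausdorff_content_def by (rule INF_lower2[of "\<lambda>_. {}"]) (use assms in auto)
  then show ?thesis by simp
qed

lemma hausdorff_content_mono: "A \<subseteq> B \<Longrightarrow> hausdorff_content d \<delta> A \<le> hausdorff_content d \<delta> B"
  unfolding hausdorff_content_def by (rule INF_superset_mono) auto

lemma hausdorff_content_antimono:
  "\<delta> \<le> \<delta>' \<Longrightarrow> hausdorff_content d \<delta>' A \<le> hausdorff_content d \<delta> A"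
  unfolding hausdorff_content_def by (rule INF_superset_mono) (auto intro: order_trans)

lemma hausdorff_content_UN:
  fixes A :: "nat \<Rightarrow> 'a::metric_space set"
  shows "hausdorff_content d \<delta> (\<Union>i. A i) \<le> (\<Sum>i. hausdorff_content d \<delta> (A i))"
proof (rule ennreal_le_epsilon)
  fix e :: real
  assume e: "0 < e" and fin: "(\<Sum>i. hausdorff_content d \<delta> (A i)) < top"
  have "\<exists>C. A n \<subseteq> (\<Union>i. C i) \<and> (\<forall>i. bounded (C i) \<and> diameter (C i) \<le> \<delta>) \<and>
      (\<Sum>i. hausdorff_gauge d (C i)) \<le> hausdorff_content d \<delta> (A n) + ennreal (e * (1/2) ^ Suc n)" for n
  proof -
    have "hausdorff_content d \<delta> (A n) < top"
      using fin by (meson ennreal_suminf_lessD)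
    then have "hausdorff_content d \<delta> (A n) < hausdorff_content d \<delta> (A n) + ennreal (e * (1/2) ^ Suc n)"
      using e by (simp add: ennreal_add_left_cancel_less[of _ 0, simplified] zero_less_mult_iff)
    then have "\<exists>C \<in> {C :: nat \<Rightarrow> 'a set. A n \<subseteq> (\<Union>i. C i) \<and> (\<forall>i. bounded (C i) \<and> diameter (C i) \<le> \<delta>)}.
       (\<Sum>i. hausdorff_gauge d (C i)) < hausdorff_content d \<delta> (A n) + ennreal (e * (1/2) ^ Suc n)"
      by (subst (asm) (1) hausdorff_content_def) (simp only: INF_less_iff)
    then show ?thesis by (auto intro: less_imp_le)
  qed
  then obtain C where C: "\<And>n. A n \<subseteq> (\<Union>i. C n i)" "\<And>n i. bounded (C n i)"
      "\<And>n i. diameter (C n i) \<le> \<delta>"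
      "\<And>n. (\<Sum>i. hausdorff_gauge d (C n i)) \<le> hausdorff_content d \<delta> (A n) + ennreal (e * (1/2) ^ Suc n)"
    by metis
  let ?D = "\<lambda>k. case_prod C (prod_decode k)"
  have "hausdorff_content d \<delta> (\<Union>i. A i) \<le> (\<Sum>k. hausdorff_gauge d (?D k))"
    unfolding hausdorff_content_def
  proof (rule INF_lower, intro CollectI conjI allI)
    show "(\<Union>i. A i) \<subseteq> (\<Union>k. ?D k)"
    proof
      fix x assume "x \<in> (\<Union>i. A i)"
      then obtain n i where "x \<in> C n i" using C(1) by blast
      then have "x \<in> ?D (prod_encode (n, i))" by simp
      then show "x \<in> (\<Union>k. ?D k)" by (rule UN_I[OF UNIV_I])
    qed
  qed (simp_all add: case_prod_unfold C(2,3))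
  also have "\<dots> = (\<Sum>k. (\<lambda>(n, i). hausdorff_gauge d (C n i)) (prod_decode k))"
    by (simp add: case_prod_unfold)
  also have "\<dots> = (\<Sum>n. \<Sum>i. hausdorff_gauge d (C n i))"
    using suminf_ennreal_2dimen[where f = "\<lambda>(n, i). hausdorff_gauge d (C n i)", OF refl]
    by (simp add: o_def)
  also have "\<dots> \<le> (\<Sum>n. hausdorff_content d \<delta> (A n) + ennreal (e * (1/2) ^ Suc n))"
    by (intro suminf_le C(4)) auto
  also have "\<dots> = (\<Sum>n. hausdorff_content d \<delta> (A n)) + (\<Sum>n. ennreal (e * (1/2) ^ Suc n))"
    by (intro suminf_add[symmetric]) auto
  also have "(\<Sum>n. ennreal (e * (1/2) ^ Suc n)) = ennreal e"
    using sums_mult[OF power_half_series, of e] e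
    by (intro suminf_ennreal_eq) auto
  finally show "hausdorff_content d \<delta> (\<Union>i. A i) \<le> (\<Sum>i. hausdorff_content d \<delta> (A i)) + ennreal e" .
qed

lemma hausdorff_outer_empty [simp]: "hausdorff_outer d {} = 0"
proof -
  have "hausdorff_outer d ({}::'a set) \<le> 0"
    unfolding hausdorff_outer_def by (rule SUP_least) auto
  then show ?thesis by simp
qed

lemma hausdorff_outer_mono: "A \<subseteq> B \<Longrightarrow> hausdorff_outer d A \<le> hausdorff_outer d B"
  unfolding hausdorff_outer_def by (rule SUP_mono) (auto intro: hausdorff_content_mono)

lemma hausdorff_outer_UN: "hausdorff_outer d (\<Union>i::nat. A i) \<le> (\<Sum>i. hausdorff_outer d (A i))"
proof -
  have "hausdorff_content d \<delta> (\<Union>i. A i) \<le> (\<Sum>i. hausdorff_outer d (A i))" if "0 < \<delta>" for \<delta>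
  proof -
    have "hausdorff_content d \<delta> (\<Union>i. A i) \<le> (\<Sum>i. hausdorff_content d \<delta> (A i))"
      by (rule hausdorff_content_UN)
    also have "\<dots> \<le> (\<Sum>i. hausdorff_outer d (A i))"
      unfolding hausdorff_outer_def using that by (intro suminf_le SUP_upper) auto
    finally show ?thesis .
  qed
  then show ?thesis
    by (subst hausdorff_outer_def) (auto intro!: SUP_least)
qed

lemma hausdorff_outer_Un: "hausdorff_outer d (A \<union> B) \<le> hausdorff_outer d A + hausdorff_outer d B"
proof -
  have "hausdorff_outer d (A \<union> B) = hausdorff_outer d (\<Union>i. binaryset A B i)"
    by (simp add: UN_binaryset_eq)
  also have "\<dots> \<le> (\<Sum>i. hausdorff_outer d (binaryset A B i))"
    by (rule hausdorff_outer_UN)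
  also have "\<dots> = hausdorff_outer d A + hausdorff_outer d B"
    by (rule suminf_binaryset_eq) simp
  finally show ?thesis .
qed

lemma hausdorff_outer_separated:
  fixes A B :: "'a::metric_space set"
  assumes r: "0 < r" and sep: "\<And>x y. x \<in> A \<Longrightarrow> y \<in> B \<Longrightarrow> r \<le> dist x y"
  shows "hausdorff_outer d A + hausdorff_outer d B \<le> hausdorff_outer d (A \<union> B)"
proof -
  have small: "hausdorff_content d \<delta> A + hausdorff_content d \<delta> B \<le> hausdorff_content d \<delta> (A \<union> B)"
    if \<delta>: "0 < \<delta>" "\<delta> < r" for \<delta>
  proof (subst (3) hausdorff_content_def, rule INF_greatest, clarify)
    fix C :: "nat \<Rightarrow> 'a set"
    assume C: "A \<union> B \<subseteq> (\<Union>i. C i)" "\<forall>i. bounded (C i) \<and> diameter (C i) \<le> \<delta>"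
    define CA where "CA i = (if C i \<inter> A = {} then {} else C i)" for i
    define CB where "CB i = (if C i \<inter> B = {} then {} else C i)" for i
    have disj: "C i \<inter> A = {} \<or> C i \<inter> B = {}" for i
    proof (rule ccontr)
      assume "\<not> (C i \<inter> A = {} \<or> C i \<inter> B = {})"
      then obtain x y where "x \<in> C i" "x \<in> A" "y \<in> C i" "y \<in> B" by auto
      then have "r \<le> diameter (C i)"
        using sep[of x y] diameter_bounded_bound[of "C i" x y] C(2) by force
      then show False using C(2) \<delta> by (meson leD order_trans)
    qed
    have "hausdorff_content d \<delta> A \<le> (\<Sum>i. hausdorff_gauge d (CA i))"
      unfolding hausdorff_content_def
      by (rule INF_lower) (use C \<delta> in \<open>auto simp: CA_def subset_iff; blast\<close>)
    moreover have "hausdorff_content d \<delta> B \<le> (\<Sum>i. hausdorff_gauge d (CB i))"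
      unfolding hausdorff_content_def
      by (rule INF_lower) (use C \<delta> in \<open>auto simp: CB_def subset_iff; blast\<close>)
    ultimately have "hausdorff_content d \<delta> A + hausdorff_content d \<delta> B \<le>
        (\<Sum>i. hausdorff_gauge d (CA i)) + (\<Sum>i. hausdorff_gauge d (CB i))"
      by (rule add_mono)
    also have "\<dots> = (\<Sum>i. hausdorff_gauge d (CA i) + hausdorff_gauge d (CB i))"
      by (intro suminf_add) auto
    also have "\<dots> \<le> (\<Sum>i. hausdorff_gauge d (C i))"
      using disj by (intro suminf_le) (auto simp: CA_def CB_def)
    finally show "hausdorff_content d \<delta> A + hausdorff_content d \<delta> B \<le> (\<Sum>i. hausdorff_gauge d (C i))" .
  qed
  have "hausdorff_content d \<delta>1 A + hausdorff_content d \<delta>2 B \<le> hausdorff_outer d (A \<union> B)"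
    if "0 < \<delta>1" "0 < \<delta>2" for \<delta>1 \<delta>2
  proof -
    define \<delta> where "\<delta> = min (min \<delta>1 \<delta>2) (r / 2)"
    have \<delta>: "0 < \<delta>" "\<delta> < r" "\<delta> \<le> \<delta>1" "\<delta> \<le> \<delta>2" using that r by (auto simp: \<delta>_def)
    have "hausdorff_content d \<delta>1 A + hausdorff_content d \<delta>2 B \<le>
        hausdorff_content d \<delta> A + hausdorff_content d \<delta> B"
      by (intro add_mono hausdorff_content_antimono \<delta>)
    also have "\<dots> \<le> hausdorff_content d \<delta> (A \<union> B)" by (rule small[OF \<delta>(1,2)])
    also have "\<dots> \<le> hausdorff_outer d (A \<union> B)"
      unfolding hausdorff_outer_def using \<delta> by (intro SUP_upper) auto
    finally show ?thesis .
  qed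
  then have "hausdorff_content d \<delta> A + hausdorff_outer d B \<le> hausdorff_outer d (A \<union> B)"
    if "0 < \<delta>" for \<delta>
    using that unfolding hausdorff_outer_def[of d B]
    by (subst ennreal_SUP_add_right) (auto intro!: SUP_least)
  then show ?thesis
    unfolding hausdorff_outer_def[of d A]
    by (subst ennreal_SUP_add_left[symmetric]) (auto intro!: SUP_least)
qed

lemma hausdorff_outer_separated_sum:
  fixes B :: "nat \<Rightarrow> 'a::metric_space set"
  assumes "\<And>i j. i < j \<Longrightarrow> \<exists>r>0. \<forall>k\<ge>j. \<forall>x\<in>B i. \<forall>y\<in>B k. r \<le> dist x y"
  shows "(\<Sum>i<m. hausdorff_outer d (B (n + i))) \<le> hausdorff_outer d (\<Union>i\<in>{..<m}. B (n + i))"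
proof (induction m arbitrary: n)
  case 0 then show ?case by simp
next
  case (Suc m)
  obtain r where r: "r > 0" "\<And>k x y. k \<ge> Suc n \<Longrightarrow> x \<in> B n \<Longrightarrow> y \<in> B k \<Longrightarrow> r \<le> dist x y"
    using assms[of n "Suc n"] by auto
  have "(\<Sum>i<Suc m. hausdorff_outer d (B (n + i))) =
      hausdorff_outer d (B n) + (\<Sum>i<m. hausdorff_outer d (B (Suc n + i)))"
    by (subst sum.lessThan_Suc_shift) simp
  also have "\<dots> \<le> hausdorff_outer d (B n) + hausdorff_outer d (\<Union>i\<in>{..<m}. B (Suc n + i))"
    by (intro add_left_mono Suc.IH)
  also have "\<dots> \<le> hausdorff_outer d (B n \<union> (\<Union>i\<in>{..<m}. B (Suc n + i)))"
    by (rule hausdorff_outer_separated[OF r(1)]) (auto intro!: r(2)[of "Suc n + _"])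
  also have "B n \<union> (\<Union>i\<in>{..<m}. B (Suc n + i)) = (\<Union>i\<in>{..<Suc m}. B (n + i))"
    by (subst lessThan_Suc_eq_insert_0) (auto simp: image_iff)
  finally show ?case .
qed

lemma hausdorff_outer_closed:
  fixes F A :: "'a::metric_space set"
  assumes F: "closed F"
  shows "hausdorff_outer d (A \<inter> F) + hausdorff_outer d (A - F) \<le> hausdorff_outer d A"
proof (cases "hausdorff_outer d A = top \<or> F = {}")
  case True then show ?thesis by auto
next
  case False
  then have fin: "hausdorff_outer d A < top" and ne: "F \<noteq> {}" by (auto simp: top.not_eq_extremum)
  define L where "L k = inverse (real (Suc k))" for k
  have L: "L k > 0" for k by (simp add: L_def)
  have L_mono: "L j \<le> L i" if "i \<le> j" for i j using that by (simp add: L_def field_simps)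
  have L_less: "L j < L i" if "i < j" for i j using that by (simp add: L_def field_simps)
  define U where "U k = {x \<in> A. L k \<le> infdist x F}" for k
  define B where "B k = {x \<in> A. L (Suc k) \<le> infdist x F \<and> infdist x F < L k}" for k
  have gap: "\<exists>r>0. \<forall>k'\<ge>k. \<forall>x\<in>B i. \<forall>y\<in>B k'. r \<le> dist x y" if "Suc i < k" for i k
  proof (intro exI conjI allI impI ballI)
    show "0 < L (Suc i) - L k" using L_less[OF that] by simp
    fix k' x y assume "k \<le> k'" "x \<in> B i" "y \<in> B k'"
    then have "L (Suc i) \<le> infdist x F" "infdist y F < L k" using L_mono[of k k'] by (auto simp: B_def)
    then show "L (Suc i) - L k \<le> dist x y"
      using infdist_triangle[of x F y] by (simp add: dist_commute)
  qed
  have BA: "B k \<subseteq> A" for k by (auto simp: B_def)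
  have sparse: "(\<Sum>i<m. hausdorff_outer d (B (2 * i + c))) \<le> hausdorff_outer d A" for m c
  proof -
    have "(\<Sum>i<m. hausdorff_outer d (B (2 * (0 + i) + c))) \<le>
        hausdorff_outer d (\<Union>i\<in>{..<m}. B (2 * (0 + i) + c))"
    proof (rule hausdorff_outer_separated_sum[of "\<lambda>i. B (2 * i + c)"])
      fix i j :: nat assume ij: "i < j"
      then obtain r where "r > 0" and
        r: "\<And>k x y. k \<ge> 2 * j + c \<Longrightarrow> x \<in> B (2 * i + c) \<Longrightarrow> y \<in> B k \<Longrightarrow> r \<le> dist x y"
        using gap[of "2 * i + c" "2 * j + c"] by auto
      then show "\<exists>r>0. \<forall>k\<ge>j. \<forall>x\<in>B (2 * i + c). \<forall>y\<in>B (2 * k + c). r \<le> dist x y"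
        by (intro exI[of _ r] conjI allI impI ballI r[of "2 * _ + c"]) auto
    qed
    also have "\<dots> \<le> hausdorff_outer d A" using BA by (intro hausdorff_outer_mono) auto
    finally show ?thesis by simp
  qed
  have split: "(\<Sum>i<2*m. f i) = (\<Sum>i<m. f (2 * i + 0)) + (\<Sum>i<m. f (2 * i + 1))"
    for f :: "nat \<Rightarrow> ennreal" and m
    by (induction m) (auto simp: algebra_simps)
  have "(\<Sum>i<m. hausdorff_outer d (B i)) \<le> hausdorff_outer d A + hausdorff_outer d A" for m
  proof -
    have "(\<Sum>i<m. hausdorff_outer d (B i)) \<le> (\<Sum>i<2*m. hausdorff_outer d (B i))"
      by (intro sum_mono2) auto
    also have "\<dots> \<le> hausdorff_outer d A + hausdorff_outer d A"
      unfolding split by (intro add_mono sparse)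
    finally show ?thesis .
  qed
  then have T: "(\<Sum>i. hausdorff_outer d (B i)) \<le> hausdorff_outer d A + hausdorff_outer d A"
    by (intro suminf_le_const) auto
  let ?T = "\<Sum>i. hausdorff_outer d (B i)"
  have "?T + (hausdorff_outer d (A \<inter> F) + hausdorff_outer d (A - F)) \<le> hausdorff_outer d A + ?T"
  proof (rule ennreal_suminf_bound_add)
    fix n
    have "A - F \<subseteq> U n \<union> (\<Union>k. B (k + n))"
    proof
      fix x assume x: "x \<in> A - F"
      then have "infdist x F > 0" by (intro infdist_pos_not_in_closed F ne) auto
      then have ex: "\<exists>k. L k \<le> infdist x F"
        unfolding L_def by (metis reals_Archimedean less_imp_le)
      define k where "k = (LEAST k. L k \<le> infdist x F)"
      have k: "L k \<le> infdist x F" unfolding k_def by (rule LeastI_ex[OF ex])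
      show "x \<in> U n \<union> (\<Union>k. B (k + n))"
      proof (cases "L n \<le> infdist x F")
        case True then show ?thesis using x by (auto simp: U_def)
      next
        case False
        then have "n < k" using k L_mono[of k n] by (cases "n < k") auto
        then obtain j where j: "k = Suc (j + n)"
          using less_imp_Suc_add[of n k] by (auto simp: add.commute)
        have "\<not> L (j + n) \<le> infdist x F"
          using not_less_Least[of "j + n" "\<lambda>k. L k \<le> infdist x F"] j by (simp add: k_def)
        then have "x \<in> B (j + n)" using x k j by (simp add: B_def)
        then show ?thesis by blast
      qed
    qed
    then have "hausdorff_outer d (A - F) \<le> hausdorff_outer d (U n \<union> (\<Union>k. B (k + n)))"
      by (rule hausdorff_outer_mono)
    also have "\<dots> \<le> hausdorff_outer d (U n) + hausdorff_outer d (\<Union>k. B (k + n))"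
      by (rule hausdorff_outer_Un)
    also have "\<dots> \<le> hausdorff_outer d (U n) + (\<Sum>k. hausdorff_outer d (B (k + n)))"
      by (intro add_left_mono hausdorff_outer_UN)
    finally have 1: "hausdorff_outer d (A - F) \<le>
        hausdorff_outer d (U n) + (\<Sum>k. hausdorff_outer d (B (k + n)))" .
    have "hausdorff_outer d (A \<inter> F) + hausdorff_outer d (U n) \<le> hausdorff_outer d (A \<inter> F \<union> U n)"
    proof (rule hausdorff_outer_separated[OF L[of n]])
      fix x y assume "x \<in> A \<inter> F" "y \<in> U n"
      then show "L n \<le> dist x y"
        using infdist_le[of x F y] by (auto simp: U_def dist_commute)
    qed
    also have "\<dots> \<le> hausdorff_outer d A" by (intro hausdorff_outer_mono) (auto simp: U_def)
    finally have 2: "hausdorff_outer d (A \<inter> F) + hausdorff_outer d (U n) \<le> hausdorff_outer d A" .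
    have "(\<Sum>i<n. hausdorff_outer d (B i)) + (hausdorff_outer d (A \<inter> F) + hausdorff_outer d (A - F)) \<le>
        (\<Sum>i<n. hausdorff_outer d (B i)) + (hausdorff_outer d (A \<inter> F) +
          (hausdorff_outer d (U n) + (\<Sum>k. hausdorff_outer d (B (k + n)))))"
      by (intro add_left_mono 1)
    also have "\<dots> = (hausdorff_outer d (A \<inter> F) + hausdorff_outer d (U n)) +
        ((\<Sum>k. hausdorff_outer d (B (k + n))) + (\<Sum>i<n. hausdorff_outer d (B i)))"
      by (simp add: ac_simps)
    also have "\<dots> = (hausdorff_outer d (A \<inter> F) + hausdorff_outer d (U n)) + ?T"
      by (subst suminf_offset[of "\<lambda>i. hausdorff_outer d (B i)" n]) auto
    also have "\<dots> \<le> hausdorff_outer d A + ?T"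
      by (intro add_right_mono 2)
    finally show "(\<Sum>i<n. hausdorff_outer d (B i)) +
      (hausdorff_outer d (A \<inter> F) + hausdorff_outer d (A - F)) \<le> hausdorff_outer d A + ?T" .
  qed
  moreover have "?T < top" using T fin by (auto intro: le_less_trans simp: ennreal_add_less_top)
  ultimately show ?thesis
    by (auto simp: add.commute[of "hausdorff_outer d A"] ennreal_add_left_cancel_le)
qed

lemma hausdorff_outer_measure_space:
  "measure_space UNIV (sets (borel :: 'a::metric_space measure)) (hausdorff_outer d)"
proof -
  let ?L = "lambda_system UNIV (Pow UNIV) (hausdorff_outer d :: 'a set \<Rightarrow> ennreal)"
  interpret P: sigma_algebra "UNIV :: 'a set" "Pow UNIV" by (rule sigma_algebra_Pow)
  have "outer_measure_space (Pow UNIV) (hausdorff_outer d :: 'a set \<Rightarrow> ennreal)"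
    by (auto simp: outer_measure_space_def positive_def increasing_def countably_subadditive_def
        intro: hausdorff_outer_mono hausdorff_outer_UN)
  then have ms: "measure_space UNIV ?L (hausdorff_outer d)"
    by (rule P.caratheodory_lemma)
  then interpret L: sigma_algebra "UNIV :: 'a set" ?L by (simp add: measure_space_def)
  have "F \<in> ?L" if "closed F" for F :: "'a set"
  proof -
    have "hausdorff_outer d (A \<inter> F) + hausdorff_outer d (A - F) = hausdorff_outer d A" for A
    proof (rule antisym[OF hausdorff_outer_closed[OF that]])
      show "hausdorff_outer d A \<le> hausdorff_outer d (A \<inter> F) + hausdorff_outer d (A - F)"
        using hausdorff_outer_Un[of d "A \<inter> F" "A - F"] by (simp add: Int_Diff_Un)
    qed
    then show ?thesis unfolding P.lambda_system_eq by simp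
  qed
  then have "sigma_sets UNIV (Collect closed) \<subseteq> ?L"
    by (intro L.sigma_sets_subset) blast
  then have "sets (borel :: 'a measure) \<subseteq> ?L"
    unfolding borel_eq_closed by (subst sets_measure_of) auto
  then show ?thesis
    using measure_down[OF ms] sets.sigma_algebra_axioms[of "borel :: 'a measure"] by simp
qed

lemma space_hausdorff_measure [simp]: "space (hausdorff_measure d) = UNIV"
  by (simp add: hausdorff_measure_def)

lemma sets_hausdorff_measure [simp, measurable_cong]: "sets (hausdorff_measure d) = sets borel"
  unfolding hausdorff_measure_def by (metis sets.sets_measure_of_eq space_borel)

lemma emeasure_hausdorff_measure:
  "A \<in> sets borel \<Longrightarrow> emeasure (hausdorff_measure d) A = hausdorff_outer d A"
  unfolding hausdorff_measure_def
  using hausdorff_outer_measure_space[of d]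
  by (intro emeasure_measure_of_sigma) (auto simp: measure_space_def)


section \<open>Hypersurfaces\<close>

text \<open>A \<open>C\<^sup>1\<close>-hypersurface is an embedded hypersurface without boundary: locally a
  level set of a \<open>C\<^sup>1\<close> function \<open>F\<close> with non-vanishing gradient \<open>DF\<close>.\<close>

definition C1_hypersurface :: "'a::real_inner set \<Rightarrow> bool" where
  "C1_hypersurface \<Gamma> \<longleftrightarrow>
    (\<forall>z\<in>\<Gamma>. \<exists>W F DF. open W \<and> z \<in> W \<and>
       (\<forall>x\<in>W. GDERIV F x :> DF x) \<and> continuous_on W DF \<and> (\<forall>x\<in>W. DF x \<noteq> 0) \<and>
       \<Gamma> \<inter> W = {x \<in> W. F x = 0})"

text \<open>Velocities at \<open>z\<close> of curves in \<open>\<Gamma>\<close> through \<open>z\<close>.\<close>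

definition tangent_space :: "'a::real_normed_vector set \<Rightarrow> 'a \<Rightarrow> 'a set" where
  "tangent_space \<Gamma> z =
    {v. \<exists>\<gamma>. \<gamma> (0::real) = z \<and> (\<forall>\<^sub>F t in at 0. \<gamma> t \<in> \<Gamma>) \<and> (\<gamma> has_vector_derivative v) (at 0)}"

definition unit_normal_mapping :: "'a::real_inner set \<Rightarrow> ('a \<Rightarrow> 'a) \<Rightarrow> bool" where
  "unit_normal_mapping \<Gamma> \<nu> \<longleftrightarrow>
    (\<forall>z\<in>\<Gamma>. norm (\<nu> z) = 1 \<and> (\<forall>v\<in>tangent_space \<Gamma> z. \<nu> z \<bullet> v = 0))"

text \<open>The surface measure is a complete measure with underlying space \<open>\<Gamma>\<close>.\<close>

definition surface_measure :: "(real ^ 'n) set \<Rightarrow> (real ^ 'n) measure" where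
  "surface_measure \<Gamma> = completion (restrict_space (hausdorff_measure (CARD('n) - 1)) \<Gamma>)"


section \<open>Rational directions\<close>

definition integer_vectors :: "(real ^ 'n) set" where
  "integer_vectors = {k. \<forall>i. k $ i \<in> \<int>}"

definition rational_direction :: "real ^ 'n \<Rightarrow> bool" where
  "rational_direction v \<longleftrightarrow> norm v = 1 \<and> (\<exists>\<alpha>. \<exists>k\<in>integer_vectors. v = \<alpha> *\<^sub>R k)"

definition IDDC :: "(real ^ 'n) set \<Rightarrow> (real ^ 'n \<Rightarrow> real ^ 'n) \<Rightarrow> bool" where
  "IDDC \<Gamma> \<nu> \<longleftrightarrow> {z \<in> \<Gamma>. rational_direction (\<nu> z)} \<in> null_sets (surface_measure \<Gamma>)"


section \<open>Functions on the torus\<close>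

text \<open>Functions on the torus are \<open>\<int>\<^sup>n\<close>-periodic functions on \<open>\<real>\<^sup>n\<close>; they are integrated over
  the fundamental domain \<open>[0,1)\<^sup>n\<close>.\<close>

definition periodic :: "(real ^ 'n \<Rightarrow> 'b) \<Rightarrow> bool" where
  "periodic f \<longleftrightarrow> (\<forall>y. \<forall>k\<in>integer_vectors. f (y + k) = f y)"

definition torus_measure :: "(real ^ 'n) measure" where
  "torus_measure = restrict_space lborel {y. \<forall>i. 0 \<le> y $ i \<and> y $ i < 1}"

definition L_infinity :: "'a measure \<Rightarrow> ('a \<Rightarrow> real) set" where
  "L_infinity M = {f \<in> borel_measurable M. \<exists>B. AE x in M. \<bar>f x\<bar> \<le> B}"

definition equicontinuous_family :: "'i set \<Rightarrow> ('i \<Rightarrow> 'a::metric_space \<Rightarrow> 'b::metric_space) \<Rightarrow> bool" where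
  "equicontinuous_family I f \<longleftrightarrow>
    (\<forall>y. \<forall>e>0. \<exists>\<delta>>0. \<forall>z\<in>I. \<forall>y'. dist y' y < \<delta> \<longrightarrow> dist (f z y') (f z y) < e)"

end

theory Submission
  imports Defs
begin

text \<open>The integrand is uniformly approximated by finite sums of products \<open>h x * T (x / \<epsilon>)\<close> with \<open>h\<close>
  integrable and \<open>T\<close> a trigonometric polynomial, which reduces the claim to a single character
  \<open>cos (2 \<pi> k \<bullet> x / \<epsilon> + c)\<close> with \<open>k \<noteq> 0\<close> integral. Wherever the normal is not parallel to \<open>k\<close>,
  the function \<open>x \<mapsto> k \<bullet> x\<close> is part of a local chart of \<open>\<Gamma>\<close>, so the slices \<open>a \<le> k \<bullet> x \<le> b\<close> of \<open>\<Gamma>\<close>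
  have locally measure \<open>O(b - a)\<close>. By IDDC the remaining points form a null set, hence \<open>x \<mapsto> k \<bullet> x\<close>
  pushes the surface measure forward to an absolutely continuous measure on the line, and the
  Riemann-Lebesgue lemma shows that the character averages to \<open>0\<close>.\<close>

section \<open>Hausdorff measure of slices of a hypersurface\<close>

text \<open>The slice bound degenerates as the normal approaches the direction of \<open>k\<close>,
  so no rate of decay is available. What survives is qualitative: \<open>k \<bullet> x\<close> pulls
  Lebesgue null sets back to null sets. This passes through countable unions and is what a
  Radon-Nikodym density requires. Two further points shape the work. The tangent space consists of
  velocities of curves, so relating \<open>\<nu> z\<close> to the gradient requires curves in
  \<Gamma> with every velocity orthogonal to the gradient; they are assembled from zeros given by
  the intermediate value theorem, without a differentiable parametrisation of \<Gamma>. And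
  \<open>g\<close> is only measurable on a completed product, where Fubini says nothing about the
  section at a prescribed \<open>y\<close>; equicontinuity carries measurability from almost every
  \<open>y\<close> to all of them. This matters because the approximating products freeze the second
  argument of \<open>g\<close> at finitely many prescribed points.\<close>

lemma hausdorff_content_finite_cover:
  assumes "finite I" "A \<subseteq> (\<Union>i\<in>I. C i)" "\<And>i. i \<in> I \<Longrightarrow> bounded (C i)"
    and "\<And>i. i \<in> I \<Longrightarrow> diameter (C i) \<le> \<delta>" "0 < \<delta>"
  shows "hausdorff_content d \<delta> A \<le> (\<Sum>i\<in>I. hausdorff_gauge d (C i))"
proof -
  obtain h where h: "bij_betw h {0..<card I} I"
    using ex_bij_betw_nat_finite[OF assms(1)] by auto
  define C' where "C' k = (if k < card I then C (h k) else {})" for k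
  have hI: "h k \<in> I" if "k < card I" for k
    using h that by (auto simp: bij_betw_def)
  have "(\<Union>i\<in>I. C i) \<subseteq> (\<Union>k. C' k)"
  proof safe
    fix x i assume "i \<in> I" "x \<in> C i"
    then obtain k where "k < card I" "h k = i"
      using h unfolding bij_betw_def by (metis atLeastLessThan_iff imageE)
    then show "x \<in> (\<Union>k. C' k)" using \<open>x \<in> C i\<close> by (auto simp: C'_def)
  qed
  then have "hausdorff_content d \<delta> A \<le> (\<Sum>k. hausdorff_gauge d (C' k))"
    unfolding hausdorff_content_def
    using assms hI by (intro INF_lower) (auto simp: C'_def)
  also have "\<dots> = (\<Sum>k\<in>{0..<card I}. hausdorff_gauge d (C' k))"
    by (intro suminf_finite) (auto simp: C'_def)
  also have "\<dots> = (\<Sum>k\<in>{0..<card I}. hausdorff_gauge d (C (h k)))"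
    by (intro sum.cong) (auto simp: C'_def)
  also have "\<dots> = (\<Sum>i\<in>I. hausdorff_gauge d (C i))"
    by (rule sum.reindex_bij_betw[OF h])
  finally show ?thesis .
qed

text \<open>If the coordinates of \<open>M\<close> other than the \<open>i\<close>-th have a joint Lipschitz inverse on \<open>A\<close>, then
  the preimages of a grid of cubes of small side \<open>s\<close> cover \<open>A\<close> efficiently.\<close>

lemma hausdorff_outer_le_box:
  fixes A :: "(real ^ 'n) set" and M :: "real ^ 'n \<Rightarrow> real ^ 'n"
  assumes M: "\<And>x y. x \<in> A \<Longrightarrow> y \<in> A \<Longrightarrow> norm (x - y) \<le> K * norm (M x - M y)"
    and Mi: "\<And>x. x \<in> A \<Longrightarrow> M x $ i = 0"
    and box: "\<And>x l. x \<in> A \<Longrightarrow> l \<noteq> i \<Longrightarrow> lo l \<le> M x $ l \<and> M x $ l \<le> lo l + w l"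
    and w: "\<And>l. l \<noteq> i \<Longrightarrow> 0 < w l" and K: "0 \<le> K"
  shows "hausdorff_outer (CARD('n) - 1) A
     \<le> ennreal (unit_ball_vol (real (CARD('n) - 1)) * (K * CARD('n)) ^ (CARD('n) - 1) * (\<Prod>l\<in>UNIV - {i}. w l))"
    (is "_ \<le> ennreal ?R")
  unfolding hausdorff_outer_def
proof (rule SUP_least)
  fix \<delta> :: real assume "\<delta> \<in> {0<..}"
  then have \<delta>: "0 < \<delta>" by simp
  define n where "n = CARD('n)"
  define d where "d = n - 1"
  define V where "V = unit_ball_vol (real d)"
  have V: "0 \<le> V" unfolding V_def by simp
  \<comment> \<open>The first bound keeps the diameter \<open>K * n * s\<close> of a cell at most
    \<delta>, with \<open>+ 1\<close> guarding against \<open>K = 0\<close>. The second gives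
    \<open>s \<le> w l\<close>, so that rounding up the number of cells per side costs at most a
    factor 2; the inserted 1 keeps the set under \<open>Min\<close> nonempty.\<close>
  define s where "s = min (\<delta> / (K * n + 1)) (Min (insert 1 (w ` (UNIV - {i}))))"
  have Kn: "0 \<le> K * n" using K by simp
  have s: "0 < s" "K * n * s \<le> \<delta>" "\<And>l. l \<noteq> i \<Longrightarrow> s \<le> w l"
  proof -
    show "0 < s" using \<delta> w Kn by (auto simp: s_def)
    have "s \<le> \<delta> / (K * n + 1)" by (simp add: s_def)
    then have "(K * n + 1) * s \<le> \<delta>" using Kn by (simp add: pos_le_divide_eq mult.commute)
    then show "K * n * s \<le> \<delta>" using \<open>0 < s\<close> by (simp add: algebra_simps)
    show "s \<le> w l" if "l \<noteq> i" for l
      unfolding s_def by (rule min.coboundedI2, rule Min_le) (use that in auto)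
  qed
  \<comment> \<open>The box is closed, so the index \<open>nat \<lfloor>w l / s\<rfloor>\<close> of
    its far face occurs too. The \<open>i\<close>-th coordinate of \<open>M\<close> vanishes on
    \<open>A\<close> and contributes a single index, which leaves \<open>d = n - 1\<close> effective
    dimensions.\<close>
  define T where "T l = (if l = i then {0} else {..nat \<lfloor>w l / s\<rfloor>})" for l
  define I where "I = PiE UNIV T"
  have finI: "finite I" unfolding I_def by (intro finite_PiE) (auto simp: T_def)
  define C where "C f = {x \<in> A. \<forall>l. l \<noteq> i \<longrightarrow> nat \<lfloor>(M x $ l - lo l) / s\<rfloor> = f l}" for f
  have close: "norm (x - y) \<le> K * n * s" if "x \<in> C f" "y \<in> C f" for x y f
  proof -
    have xy: "x \<in> A" "y \<in> A" using that by (auto simp: C_def)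
    have c: "\<bar>M x $ l - M y $ l\<bar> \<le> s" for l
    proof (cases "l = i")
      case True then show ?thesis using Mi xy s by simp
    next
      case False
      define u where "u = (M x $ l - lo l) / s"
      define v where "v = (M y $ l - lo l) / s"
      have uv: "0 \<le> u" "0 \<le> v" using box[OF xy(1) False] box[OF xy(2) False] s by (auto simp: u_def v_def)
      have "nat \<lfloor>u\<rfloor> = nat \<lfloor>v\<rfloor>" using that False by (auto simp: C_def u_def v_def)
      then have "\<lfloor>u\<rfloor> = \<lfloor>v\<rfloor>" using uv by (metis eq_nat_nat_iff zero_le_floor)
      then have "\<bar>u - v\<bar> \<le> 1" by linarith
      moreover have "M x $ l - M y $ l = (u - v) * s" using s by (simp add: u_def v_def field_simps)
      ultimately show ?thesis using s(1) by (simp add: abs_mult mult_le_cancel_right1)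
    qed
    \<comment> \<open>Bounding the norm by the sum of the coordinates puts the factor
      \<open>CARD('n)\<close> into the constant.\<close>
    have "norm (M x - M y) \<le> (\<Sum>l\<in>UNIV. \<bar>(M x - M y) $ l\<bar>)" by (rule norm_le_l1_cart)
    also have "\<dots> \<le> (\<Sum>l\<in>(UNIV::'n set). s)" by (intro sum_mono) (use c in auto)
    finally have "norm (M x - M y) \<le> n * s" by (simp add: n_def)
    then have "K * norm (M x - M y) \<le> K * (n * s)" using K by (rule mult_left_mono)
    with M[OF xy] show ?thesis by (simp add: mult.assoc)
  qed
  have dia: "diameter (C f) \<le> K * n * s" for f
    using close Kn s by (intro diameter_le) auto
  have bdd: "bounded (C f)" for f
    unfolding bounded_two_points using close by (auto simp: dist_norm)
  have cov: "A \<subseteq> (\<Union>f\<in>I. C f)"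
  proof
    fix x assume x: "x \<in> A"
    define f where "f l = (if l = i then 0 else nat \<lfloor>(M x $ l - lo l) / s\<rfloor>)" for l
    have "nat \<lfloor>(M x $ l - lo l) / s\<rfloor> \<le> nat \<lfloor>w l / s\<rfloor>" if "l \<noteq> i" for l
      using box[OF x that] s(1) by (intro nat_mono floor_mono divide_right_mono) auto
    then have "f \<in> I" by (auto simp: I_def T_def f_def)
    moreover have "x \<in> C f" using x by (auto simp: C_def f_def)
    ultimately show "x \<in> (\<Union>f\<in>I. C f)" by blast
  qed
  have "hausdorff_content d \<delta> A \<le> (\<Sum>f\<in>I. hausdorff_gauge d (C f))"
    by (rule hausdorff_content_finite_cover[OF finI cov bdd _ \<delta>]) (use dia s in \<open>auto intro: order_trans\<close>)
  also have "\<dots> \<le> (\<Sum>f\<in>I. ennreal (V * (K * n * s / 2) ^ d))"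
    using dia V by (intro sum_mono) (auto simp: hausdorff_gauge_def V_def bdd diameter_ge_0
      intro!: ennreal_leI mult_left_mono power_mono divide_right_mono)
  also have "\<dots> = ennreal (real (card I) * (V * (K * n * s / 2) ^ d))"
    using V Kn s by (simp add: ennreal_of_nat_eq_real_of_nat ennreal_mult)
  also have "real (card I) = (\<Prod>l\<in>UNIV. real (card (T l)))"
    unfolding I_def by (subst card_PiE) auto
  also have "\<dots> = (\<Prod>l\<in>UNIV - {i}. real (card (T l)))"
    by (rule prod.mono_neutral_right) (auto simp: T_def)
  also have "\<dots> * (V * (K * n * s / 2) ^ d) = V * (K * n) ^ d * (\<Prod>l\<in>UNIV - {i}. real (card (T l)) * (s / 2))"
  proof -
    have "(\<Prod>l\<in>UNIV - {i}. s / 2) = (s / 2) ^ d" by (simp add: d_def n_def card_Diff_singleton)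
    moreover have "(K * n * s / 2) ^ d = (K * n) ^ d * (s / 2) ^ d"
      by (simp only: power_mult_distrib[symmetric] times_divide_eq_right)
    ultimately show ?thesis by (simp only: prod.distrib) (simp only: ac_simps)
  qed
  also have "\<dots> \<le> V * (K * n) ^ d * (\<Prod>l\<in>UNIV - {i}. w l)"
  proof (intro mult_left_mono prod_mono conjI)
    fix l assume l: "l \<in> UNIV - {i}"
    have "real (card (T l)) = real_of_int \<lfloor>w l / s\<rfloor> + 1"
      using l w[of l] s(1) by (simp add: T_def)
    \<comment> \<open>The factor 2 lost to rounding is cancelled by the 1/2 with which the gauge
      weighs the diameter.\<close>
    also have "\<dots> \<le> w l / s + w l / s"
      using l s(1) s(3)[of l] by (intro add_mono of_int_floor_le) auto
    finally show "real (card (T l)) * (s / 2) \<le> w l" using s(1) by (simp add: field_simps)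
  qed (use V Kn s in auto)
  finally show "hausdorff_content (CARD('n) - 1) \<delta> A \<le> ennreal ?R"
    by (auto simp: d_def n_def V_def intro: order_trans ennreal_leI)
qed

text \<open>The hypothesis controls closed intervals only. Outer regularity of Lebesgue measure
  covers a bounded part of \<open>N\<close> by nonoverlapping intervals of arbitrarily small total
  length, and countable subadditivity of \<mu> turns this into a small \<mu>-measure.\<close>

lemma null_sets_of_interval_bound:
  fixes \<mu> :: "real measure"
  assumes sets: "sets \<mu> = sets borel"
    and le: "\<And>a b. a < b \<Longrightarrow> emeasure \<mu> {a..b} \<le> ennreal (C * (b - a))"
    and C: "0 \<le> C" and N: "N \<in> null_sets lborel"
  shows "N \<in> null_sets \<mu>"
proof -
  have Nb: "N \<in> sets borel" using N by auto
  have bounded_part: "emeasure \<mu> (N \<inter> cbox (-r) r) \<le> 0 + ennreal e" if e: "0 < e" and r: "0 < r" for e r :: real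
  proof -
    have null: "N \<inter> cbox (-r) r \<in> null_sets lborel" using N by (auto intro: null_set_Int2)
    then have leb: "N \<inter> cbox (-r) r \<in> null_sets lebesgue" by (simp add: null_sets_completionI)
    have ne: "box (-r) r \<noteq> {}" using r by (auto simp: box_ne_empty)
    \<comment> \<open>Dividing by \<open>C + 1\<close> instead of \<open>C\<close> keeps the
      tolerance meaningful for \<open>C = 0\<close>. The cells have disjoint interiors, so their
      lengths add up to at most the measure of the union.\<close>
    obtain D where D: "countable D"
        "\<And>K. K \<in> D \<Longrightarrow> K \<subseteq> cbox (-r) r \<and> K \<noteq> {} \<and> (\<exists>c d. K = cbox c d)"
        "pairwise (\<lambda>A B. interior A \<inter> interior B = {}) D"
        "\<And>K. K \<in> D \<Longrightarrow> interior K \<noteq> {}"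
        "N \<inter> cbox (-r) r \<subseteq> \<Union>D" "\<Union>D \<in> lmeasurable"
        "measure lebesgue (\<Union>D) \<le> measure lebesgue (N \<inter> cbox (-r) r) + e / (C + 1)"
    proof (rule measurable_outer_intervals_bounded[of "N \<inter> cbox (-r) r" "-r" r "e / (C + 1)"])
      show "N \<inter> cbox (-r) r \<in> lmeasurable" using leb by (metis fmeasurableI_null_sets)
    qed (use e C ne in auto)
    have cell: "\<exists>c d. c < d \<and> K = {c..d}" if "K \<in> D" for K
      using D(2)[OF that] D(4)[OF that] by force
    have Db: "K \<in> sets borel" if "K \<in> D" for K using cell[OF that] by auto
    \<comment> \<open>The family \<open>D\<close> may be finite, so its enumeration is padded with
      empty sets.\<close>
    define E where "E k = (if k \<in> to_nat_on D ` D then from_nat_into D k else {})" for k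
    have E: "E k = {} \<or> E k \<in> D" for k using D(1) by (auto simp: E_def)
    have UE: "(\<Union>k. E k) = \<Union>D"
    proof
      show "(\<Union>k. E k) \<subseteq> \<Union>D" using E by blast
      show "\<Union>D \<subseteq> (\<Union>k. E k)"
      proof
        fix x assume "x \<in> \<Union>D"
        then obtain K where "K \<in> D" "x \<in> K" by blast
        then have "x \<in> E (to_nat_on D K)" using D(1) by (auto simp: E_def)
        then show "x \<in> (\<Union>k. E k)" by blast
      qed
    qed
    have disj: "disjoint_family (\<lambda>k. interior (E k))"
    proof (unfold disjoint_family_on_def, intro ballI impI)
      fix k l :: nat assume "k \<noteq> l"
      show "interior (E k) \<inter> interior (E l) = {}"
      proof (cases "k \<in> to_nat_on D ` D \<and> l \<in> to_nat_on D ` D")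
        case True
        then obtain K L where KL: "K \<in> D" "L \<in> D" "k = to_nat_on D K" "l = to_nat_on D L" by blast
        then have "K \<noteq> L" using \<open>k \<noteq> l\<close> by auto
        then have "interior K \<inter> interior L = {}" using D(3) KL by (auto simp: pairwise_def)
        then show ?thesis using KL D(1) by (simp add: E_def)
      qed (auto simp: E_def)
    qed
    have Eb: "E k \<in> sets borel" for k using E[of k] Db by auto
    have UEb: "(\<Union>k. E k) \<in> sets borel" using Eb by auto
    have "(\<Sum>k. emeasure lborel (interior (E k))) = emeasure lborel (\<Union>k. interior (E k))"
      using disj by (intro suminf_emeasure) auto
    also have "\<dots> \<le> emeasure lborel (\<Union>k. E k)"
      using Eb interior_subset by (intro emeasure_mono) auto
    also have "\<dots> = emeasure lborel (\<Union>D)" by (simp add: UE)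
    also have "\<dots> = emeasure lebesgue (\<Union>D)"
      using UEb UE by simp
    also have "\<dots> = ennreal (measure lebesgue (\<Union>D))"
      using D(6) by (simp add: emeasure_eq_measure2)
    also have "\<dots> \<le> ennreal (e / (C + 1))"
      using D(7) leb by (intro ennreal_leI) (simp add: null_sets_def measure_def)
    finally have small: "(\<Sum>k. emeasure lborel (interior (E k))) \<le> ennreal (e / (C + 1))" .
    have "emeasure \<mu> (N \<inter> cbox (-r) r) \<le> emeasure \<mu> (\<Union>k. E k)"
      using D(5) UEb UE by (intro emeasure_mono) (simp_all add: sets)
    also have "\<dots> \<le> (\<Sum>k. emeasure \<mu> (E k))"
      by (rule emeasure_subadditive_countably) (use Eb sets in auto)
    also have "\<dots> \<le> (\<Sum>k. ennreal C * emeasure lborel (interior (E k)))"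
    proof (rule suminf_le)
      fix k
      show "emeasure \<mu> (E k) \<le> ennreal C * emeasure lborel (interior (E k))"
      proof (cases "E k = {}")
        case False
        then obtain c d where "c < d" "E k = {c..d}" using cell E by metis
        then show ?thesis using le[of c d] C by (simp add: ennreal_mult)
      qed simp
    qed auto
    also have "\<dots> = ennreal C * (\<Sum>k. emeasure lborel (interior (E k)))"
      by simp
    also have "\<dots> \<le> ennreal C * ennreal (e / (C + 1))"
      by (intro mult_left_mono small) simp
    also have "\<dots> \<le> ennreal e"
      using C e by (simp add: ennreal_mult[symmetric] field_simps)
    finally show ?thesis by simp
  qed
  \<comment> \<open>\<open>Suc m\<close> keeps the radius positive, as \<open>bounded_part\<close>
    requires.\<close>
  have "N \<inter> cbox (- real (Suc m)) (real (Suc m)) \<in> null_sets \<mu>" for m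
  proof (rule null_setsI)
    have "emeasure \<mu> (N \<inter> cbox (- real (Suc m)) (real (Suc m))) \<le> 0"
      by (rule ennreal_le_epsilon, rule bounded_part) auto
    then show "emeasure \<mu> (N \<inter> cbox (- real (Suc m)) (real (Suc m))) = 0" by simp
  qed (use Nb sets in auto)
  then have "(\<Union>m. N \<inter> cbox (- real (Suc m)) (real (Suc m))) \<in> null_sets \<mu>" by (rule null_sets_UN)
  also have "(\<Union>m. N \<inter> cbox (- real (Suc m)) (real (Suc m))) = N"
  proof -
    have "\<exists>m. x \<in> cbox (- real (Suc m)) (real (Suc m))" for x :: real
    proof -
      obtain m where "\<bar>x\<bar> \<le> real m" using real_arch_simple by blast
      then show ?thesis by (intro exI[of _ m]) auto
    qed
    then show ?thesis by blast
  qed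
  finally show ?thesis .
qed

section \<open>Local charts of a hypersurface\<close>

lemma C1_hypersurfaceE:
  assumes "C1_hypersurface \<Gamma>" "z \<in> \<Gamma>"
  obtains W F DF where "open W" "z \<in> W" "\<And>x. x \<in> W \<Longrightarrow> GDERIV F x :> DF x" "continuous_on W DF"
      "DF z \<noteq> 0" "\<Gamma> \<inter> W = {x \<in> W. F x = 0}"
proof -
  have "\<exists>W F DF. open W \<and> z \<in> W \<and> (\<forall>x\<in>W. GDERIV F x :> DF x) \<and> continuous_on W DF \<and>
      (\<forall>x\<in>W. DF x \<noteq> 0) \<and> \<Gamma> \<inter> W = {x \<in> W. F x = 0}"
    using assms unfolding C1_hypersurface_def by (rule bspec)
  then show thesis by (elim exE conjE) (rule that, auto)
qed

text \<open>Vanishing of all 2x2 minors means rank at most 1. The contrapositive supplies the two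
  coordinates that the gradient and \<open>p\<close> replace in a chart.\<close>

lemma parallel_of_minors_vec:
  fixes D p :: "real ^ 'n"
  assumes "\<And>i j. D $ i * p $ j = D $ j * p $ i" "p \<noteq> 0"
  shows "\<exists>\<alpha>. D = \<alpha> *\<^sub>R p"
proof -
  obtain j where j: "p $ j \<noteq> 0" using assms(2) by (auto simp: vec_eq_iff)
  have "D = (D $ j / p $ j) *\<^sub>R p"
    using assms(1) j by (simp add: vec_eq_iff field_simps)
  then show ?thesis ..
qed

text \<open>The mean value inequality for \<open>F\<close> minus its linear part. On the zero set it
  makes \<open>D \<bullet> (x - y)\<close> small relative to \<open>x - y\<close>, which substitutes
  for the implicit function theorem.\<close>

lemma convex_gradient_bound:
  fixes F :: "'a::real_inner \<Rightarrow> real"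
  assumes F: "\<And>x. x \<in> B \<Longrightarrow> GDERIV F x :> DF x" and B: "convex B"
    and D: "\<And>x. x \<in> B \<Longrightarrow> norm (DF x - D) \<le> \<eta>" and xy: "x \<in> B" "y \<in> B"
  shows "\<bar>(F x - F y) - D \<bullet> (x - y)\<bar> \<le> \<eta> * norm (x - y)"
proof -
  have d: "((\<lambda>x. F x - D \<bullet> x) has_derivative (\<lambda>h. h \<bullet> DF x - D \<bullet> h)) (at x within B)" if "x \<in> B" for x
    using F[OF that] unfolding gderiv_def
    by (auto intro!: derivative_eq_intros intro: has_derivative_at_withinI)
  have "norm ((F x - D \<bullet> x) - (F y - D \<bullet> y)) \<le> \<eta> * norm (x - y)"
  proof (rule differentiable_bound[OF B d])
    fix u assume u: "u \<in> B"
    show "onorm (\<lambda>h. h \<bullet> DF u - D \<bullet> h) \<le> \<eta>"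
    proof (rule onorm_bound)
      show "0 \<le> \<eta>" using D[OF u] norm_ge_zero order_trans by blast
      fix h
      have "norm (h \<bullet> DF u - D \<bullet> h) = \<bar>(DF u - D) \<bullet> h\<bar>" by (simp add: inner_diff_left inner_commute[of h])
      also have "\<dots> \<le> norm (DF u - D) * norm h" by (rule Cauchy_Schwarz_ineq2)
      also have "\<dots> \<le> \<eta> * norm h" using D[OF u] by (intro mult_right_mono) auto
      finally show "norm (h \<bullet> DF u - D \<bullet> h) \<le> \<eta> * norm h" .
    qed
  qed (use xy in auto)
  then show ?thesis by (simp add: inner_diff_right algebra_simps)
qed

text \<open>Near a point where \<open>p\<close> is not normal, \<open>p \<bullet> x\<close> together with all but two of the coordinates
  forms a chart of the hypersurface with Lipschitz inverse.\<close>

lemma C1_hypersurface_slice_bound: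
  fixes \<Gamma> :: "(real ^ 'n) set"
  assumes W: "open W" "z \<in> W" "\<And>x. x \<in> W \<Longrightarrow> GDERIV F x :> DF x" "continuous_on W DF"
    and \<Gamma>: "\<Gamma> \<inter> W = {x \<in> W. F x = 0}"
    and ij: "DF z $ i * p $ j \<noteq> DF z $ j * p $ i"
  shows "\<exists>r>0. \<exists>C\<ge>0. \<forall>a b. a < b \<longrightarrow>
      hausdorff_outer (CARD('n) - 1) (\<Gamma> \<inter> ball z r \<inter> {x. p \<bullet> x \<in> {a..b}}) \<le> ennreal (C * (b - a))"
proof -
  define D where "D = DF z"
  have "i \<noteq> j" using ij by auto
  \<comment> \<open>The determinant of \<open>L\<close> is the minor in \<open>ij\<close>, so
    \<open>L\<close> is invertible. \<open>M\<close> suppresses the entry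
    \<open>D \<bullet> x\<close>, which barely varies along \<Gamma> near \<open>z\<close>.\<close>
  define L :: "real ^ 'n \<Rightarrow> real ^ 'n" where
    "L x = (\<chi> l. if l = i then D \<bullet> x else if l = j then p \<bullet> x else x $ l)" for x
  define M :: "real ^ 'n \<Rightarrow> real ^ 'n" where "M x = (\<chi> l. if l = i then 0 else L x $ l)" for x
  have lin: "linear L"
    by (rule linearI) (auto simp: L_def vec_eq_iff inner_add_right)
  have "inj L"
  proof (subst linear_injective_0[OF lin], intro allI impI)
    fix x assume "L x = 0"
    then have L0: "L x $ l = 0" for l by simp
    have Dx: "D \<bullet> x = 0" and px: "p \<bullet> x = 0" using L0[of i] L0[of j] \<open>i \<noteq> j\<close> by (auto simp: L_def)
    have xl: "x $ l = 0" if "l \<noteq> i" "l \<noteq> j" for l using L0[of l] that by (simp add: L_def)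
    have two: "q \<bullet> x = q $ i * x $ i + q $ j * x $ j" for q
    proof -
      have "q \<bullet> x = (\<Sum>l\<in>UNIV. q $ l * x $ l)" by (simp add: inner_vec_def)
      also have "\<dots> = (\<Sum>l\<in>{i, j}. q $ l * x $ l)"
        using xl by (intro sum.mono_neutral_right) auto
      finally show ?thesis using \<open>i \<noteq> j\<close> by simp
    qed
    have e: "D $ i * x $ i + D $ j * x $ j = 0" "p $ i * x $ i + p $ j * x $ j = 0"
      using Dx px two by auto
    \<comment> \<open>Cramer's rule for the two remaining unknowns \<open>x $ i\<close> and
      \<open>x $ j\<close>.\<close>
    have "(D $ i * p $ j - D $ j * p $ i) * x $ i = p $ j * (D $ i * x $ i + D $ j * x $ j) - D $ j * (p $ i * x $ i + p $ j * x $ j)"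
      "(D $ i * p $ j - D $ j * p $ i) * x $ j = D $ i * (p $ i * x $ i + p $ j * x $ j) - p $ i * (D $ i * x $ i + D $ j * x $ j)"
      by (simp_all add: algebra_simps)
    then have "(D $ i * p $ j - D $ j * p $ i) * x $ i = 0" "(D $ i * p $ j - D $ j * p $ i) * x $ j = 0"
      using e by simp_all
    then have "x $ i = 0" "x $ j = 0" using ij by (auto simp: D_def)
    then have "x $ l = 0" for l using xl[of l] by (cases "l = i"; cases "l = j") auto
    then show "x = 0" by (simp add: vec_eq_iff)
  qed
  obtain \<beta> where \<beta>: "\<beta> > 0" "\<And>x. \<beta> * norm x \<le> norm (L x)"
    using linear_inj_bounded_below_pos[OF lin \<open>inj L\<close>] by blast
  have "isCont DF z" using W by (simp add: continuous_on_eq_continuous_at)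
  \<comment> \<open>Half of the lower bound \<beta> is reserved for the entry
    \<open>D \<bullet> (x - y)\<close>; the other half remains for \<open>M\<close> and yields the
    Lipschitz constant \<open>2 / \<beta>\<close>.\<close>
  then obtain r1 where r1: "r1 > 0" "\<And>x. dist x z < r1 \<Longrightarrow> dist (DF x) D < \<beta> / 2"
    unfolding continuous_at_eps_delta D_def using \<beta>(1) by (meson half_gt_zero)
  obtain r2 where r2: "r2 > 0" "ball z r2 \<subseteq> W" using W openE by metis
  \<comment> \<open>A radius of at most 1/2 confines each unchanged coordinate to an interval of
    length 1, so that \<open>b - a\<close>, the side belonging to \<open>j\<close>, is all that
    remains of the product of sides.\<close>
  define r where "r = min (min r1 r2) (1 / 2)"
  have r: "r > 0" "r \<le> 1 / 2" "ball z r \<subseteq> W"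
    using r1 r2 by (auto simp: r_def)
  have lip: "norm (x - y) \<le> (2 / \<beta>) * norm (M x - M y)"
    if "x \<in> \<Gamma> \<inter> ball z r" "y \<in> \<Gamma> \<inter> ball z r" for x y
  proof -
    have "F x = 0" "F y = 0" using that r \<Gamma> by auto
    moreover have "\<bar>(F x - F y) - D \<bullet> (x - y)\<bar> \<le> (\<beta> / 2) * norm (x - y)"
    proof (rule convex_gradient_bound[of "ball z r" F DF])
      show "norm (DF u - D) \<le> \<beta> / 2" if "u \<in> ball z r" for u
      proof -
        have "dist u z < r1" using that by (simp add: r_def dist_commute)
        then show ?thesis using r1(2)[of u] by (simp add: dist_norm)
      qed
    qed (use W r that in auto)
    ultimately have Dxy: "\<bar>D \<bullet> (x - y)\<bar> \<le> (\<beta> / 2) * norm (x - y)" by simp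
    have "L (x - y) = (M x - M y) + axis i (D \<bullet> (x - y))"
      by (auto simp: vec_eq_iff M_def L_def axis_def inner_diff_right)
    then have "norm (L (x - y)) \<le> norm (M x - M y) + \<bar>D \<bullet> (x - y)\<bar>"
      using norm_triangle_ineq[of "M x - M y" "axis i (D \<bullet> (x - y))"] by (simp add: norm_eq_sqrt_inner[of "axis i _"] inner_axis_axis)
    with \<beta>(2)[of "x - y"] Dxy have "\<beta> * norm (x - y) \<le> 2 * norm (M x - M y)" by argo
    then show ?thesis using \<beta>(1) by (simp add: field_simps)
  qed
  define C where "C = unit_ball_vol (real (CARD('n) - 1)) * ((2 / \<beta>) * CARD('n)) ^ (CARD('n) - 1)"
  have C: "0 \<le> C" using \<beta>(1) by (simp add: C_def)
  show ?thesis
  proof (rule exI[of _ r], intro conjI exI[of _ C] allI impI)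
    fix a b :: real assume ab: "a < b"
    define lo where "lo l = (if l = j then a else z $ l - 1/2)" for l
    define w where "w l = (if l = j then b - a else 1)" for l
    have "hausdorff_outer (CARD('n) - 1) (\<Gamma> \<inter> ball z r \<inter> {x. p \<bullet> x \<in> {a..b}})
        \<le> ennreal (unit_ball_vol (real (CARD('n) - 1)) * ((2 / \<beta>) * CARD('n)) ^ (CARD('n) - 1) *
            (\<Prod>l\<in>UNIV - {i}. w l))"
    proof (rule hausdorff_outer_le_box[where M = M and lo = lo])
      fix x l assume x: "x \<in> \<Gamma> \<inter> ball z r \<inter> {x. p \<bullet> x \<in> {a..b}}" and l: "l \<noteq> i"
      have "\<bar>(x - z) $ l\<bar> \<le> norm (x - z)" by (rule component_le_norm_cart)
      also have "\<dots> \<le> 1 / 2" using x r(2) by (simp add: dist_norm norm_minus_commute)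
      finally have "\<bar>x $ l - z $ l\<bar> \<le> 1 / 2" by simp
      then have "z $ l - 1 / 2 \<le> x $ l" "x $ l \<le> z $ l + 1 / 2" by linarith+
      then show "lo l \<le> M x $ l \<and> M x $ l \<le> lo l + w l"
        using x l by (auto simp: M_def L_def lo_def w_def)
    qed (use lip ab \<beta>(1) in \<open>auto simp: M_def w_def\<close>)
    also have "(\<Prod>l\<in>UNIV - {i}. w l) = (\<Prod>l\<in>{j}. w l)"
      by (rule prod.mono_neutral_right) (use \<open>i \<noteq> j\<close> in \<open>auto simp: w_def\<close>)
    finally show "hausdorff_outer (CARD('n) - 1) (\<Gamma> \<inter> ball z r \<inter> {x. p \<bullet> x \<in> {a..b}}) \<le> ennreal (C * (b - a))"
      by (simp add: C_def w_def)
  qed (use r C in auto)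
qed

text \<open>By the slice bound, the image under \<open>p \<bullet> x\<close> of Hausdorff measure on
  the piece gives an interval a mass at most proportional to its length, which is the situation of
  \<open>null_sets_of_interval_bound\<close>.\<close>

lemma C1_hypersurface_level_null:
  fixes \<Gamma> :: "(real ^ 'n) set"
  assumes "open W" "z \<in> W" "\<And>x. x \<in> W \<Longrightarrow> GDERIV F x :> DF x" "continuous_on W DF"
    and "\<Gamma> \<inter> W = {x \<in> W. F x = 0}" and "DF z $ i * p $ j \<noteq> DF z $ j * p $ i"
    and \<Gamma>: "\<Gamma> \<in> sets borel" and N: "N \<in> null_sets lborel"
  shows "\<exists>r>0. \<Gamma> \<inter> ball z r \<inter> {x. p \<bullet> x \<in> N} \<in> null_sets (hausdorff_measure (CARD('n) - 1))"
proof -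
  obtain r C where r: "r > 0" "C \<ge> 0" and le: "\<And>a b. a < b \<Longrightarrow>
      hausdorff_outer (CARD('n) - 1) (\<Gamma> \<inter> ball z r \<inter> {x. p \<bullet> x \<in> {a..b}}) \<le> ennreal (C * (b - a))"
    using C1_hypersurface_slice_bound[OF assms(1-6)] by blast
  define M where "M = restrict_space (hausdorff_measure (CARD('n) - 1)) (\<Gamma> \<inter> ball z r)"
  define \<mu> where "\<mu> = distr M borel (\<lambda>x. p \<bullet> x)"
  have G: "\<Gamma> \<inter> ball z r \<in> sets borel" using \<Gamma> by auto
  have meas: "(\<lambda>x. p \<bullet> x) \<in> M \<rightarrow>\<^sub>M borel"
    unfolding M_def by (intro measurable_restrict_space1) simp
  have \<mu>: "emeasure \<mu> E = emeasure (hausdorff_measure (CARD('n) - 1)) (\<Gamma> \<inter> ball z r \<inter> {x. p \<bullet> x \<in> E})"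
    if "E \<in> sets borel" for E
  proof -
    have "emeasure \<mu> E = emeasure M ((\<lambda>x. p \<bullet> x) -` E \<inter> space M)"
      unfolding \<mu>_def by (rule emeasure_distr[OF meas that])
    also have "(\<lambda>x. p \<bullet> x) -` E \<inter> space M = \<Gamma> \<inter> ball z r \<inter> {x. p \<bullet> x \<in> E}"
      by (auto simp: M_def space_restrict_space)
    also have "emeasure M \<dots> = emeasure (hausdorff_measure (CARD('n) - 1)) (\<Gamma> \<inter> ball z r \<inter> {x. p \<bullet> x \<in> E})"
      unfolding M_def by (rule emeasure_restrict_space) (use G in auto)
    finally show ?thesis .
  qed
  have Nb: "N \<in> sets borel" using N by auto
  have pE: "{x. p \<bullet> x \<in> E} \<in> sets borel" if "E \<in> sets borel" for E
  proof -
    have "(\<lambda>x. p \<bullet> x) -` E \<inter> space borel \<in> sets borel"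
      by (rule measurable_sets[OF _ that]) simp
    then show ?thesis by (simp add: vimage_def)
  qed
  have "N \<in> null_sets \<mu>"
  proof (rule null_sets_of_interval_bound[OF _ _ r(2) N])
    fix a b :: real assume "a < b"
    moreover have "\<Gamma> \<inter> ball z r \<inter> {x. p \<bullet> x \<in> {a..b}} \<in> sets borel"
      by (rule sets.Int[OF G pE]) simp
    ultimately show "emeasure \<mu> {a..b} \<le> ennreal (C * (b - a))"
      using le[of a b] by (simp add: \<mu> emeasure_hausdorff_measure del: atLeastAtMost_iff)
  qed (simp add: \<mu>_def)
  then have "emeasure \<mu> N = 0" by auto
  then have "emeasure (hausdorff_measure (CARD('n) - 1)) (\<Gamma> \<inter> ball z r \<inter> {x. p \<bullet> x \<in> N}) = 0"
    using \<mu>[OF Nb] by simp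
  moreover have "\<Gamma> \<inter> ball z r \<inter> {x. p \<bullet> x \<in> N} \<in> sets borel"
    by (rule sets.Int[OF G pE[OF Nb]])
  ultimately have "\<Gamma> \<inter> ball z r \<inter> {x. p \<bullet> x \<in> N} \<in> null_sets (hausdorff_measure (CARD('n) - 1))"
    by (intro null_setsI) (simp_all only: sets_hausdorff_measure)
  with r(1) show ?thesis by blast
qed

text \<open>A slice wide enough to contain the whole ball has finite measure. In dimension at least
  2 some coordinate direction is not normal and can serve as \<open>p\<close>.\<close>

lemma C1_hypersurface_locally_finite:
  fixes \<Gamma> :: "(real ^ 'n) set"
  assumes card: "CARD('n) \<ge> 2" and \<Gamma>: "C1_hypersurface \<Gamma>" and z: "z \<in> \<Gamma>"
  shows "\<exists>r>0. hausdorff_outer (CARD('n) - 1) (\<Gamma> \<inter> ball z r) < \<infinity>"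
proof -
  obtain W F DF where W: "open W" "z \<in> W" "\<And>x. x \<in> W \<Longrightarrow> GDERIV F x :> DF x" "continuous_on W DF"
      "DF z \<noteq> 0" "\<Gamma> \<inter> W = {x \<in> W. F x = 0}"
    using \<Gamma> z by (rule C1_hypersurfaceE) blast
  obtain i where i: "DF z $ i \<noteq> 0" using W(5) by (auto simp: vec_eq_iff)
  have "\<exists>j. j \<noteq> i"
  proof (rule ccontr)
    assume "\<nexists>j. j \<noteq> i"
    then have "(UNIV :: 'n set) = {i}" by auto
    then have "CARD('n) = card {i}" by (rule arg_cong)
    then show False using card by simp
  qed
  then obtain j where j: "j \<noteq> i" by blast
  \<comment> \<open>With this \<open>p\<close> the minor reduces to \<open>DF z $ i\<close>.\<close>
  define p :: "real ^ 'n" where "p = axis j 1"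
  have "DF z $ i * p $ j \<noteq> DF z $ j * p $ i" using i j by (simp add: p_def axis_def)
  then obtain r C where r: "r > 0" and le: "\<And>a b. a < b \<Longrightarrow>
      hausdorff_outer (CARD('n) - 1) (\<Gamma> \<inter> ball z r \<inter> {x. p \<bullet> x \<in> {a..b}}) \<le> ennreal (C * (b - a))"
    using C1_hypersurface_slice_bound[OF W(1-4) W(6)] by blast
  have "\<bar>p \<bullet> x - p \<bullet> z\<bar> \<le> r" if "x \<in> ball z r" for x
  proof -
    have "\<bar>p \<bullet> (x - z)\<bar> \<le> norm p * norm (x - z)" by (rule Cauchy_Schwarz_ineq2)
    then show ?thesis using that by (simp add: p_def inner_diff_right dist_norm norm_minus_commute)
  qed
  then have "\<Gamma> \<inter> ball z r = \<Gamma> \<inter> ball z r \<inter> {x. p \<bullet> x \<in> {p \<bullet> z - r..p \<bullet> z + r}}"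
    by (force simp: abs_le_iff)
  then have "hausdorff_outer (CARD('n) - 1) (\<Gamma> \<inter> ball z r) < \<infinity>"
    using le[of "p \<bullet> z - r" "p \<bullet> z + r"] r by (simp add: le_less_trans[OF _ ennreal_less_top])
  then show ?thesis using r by blast
qed

section \<open>Tangent space and surface measure\<close>

text \<open>Along \<open>v\<close> the function changes by \<open>o(t)\<close> only, whereas a
  displacement \<open>s\<close> along the gradient changes it at rate
  \<open>(norm (DF z))\<^sup>2\<close>. Hence \<open>F\<close> passes from nonpositive to
  nonnegative between \<open>s = - (e * \<bar>t\<bar>)\<close> and
  \<open>s = e * \<bar>t\<bar>\<close>, and the intermediate value theorem applies.\<close>

lemma zero_near_tangent_line:
  fixes F :: "'a::real_inner \<Rightarrow> real"
  assumes W: "open W" "z \<in> W" and F: "\<And>x. x \<in> W \<Longrightarrow> GDERIV F x :> DF x"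
    and D: "DF z \<noteq> 0" and z: "F z = 0" and v: "v \<bullet> DF z = 0" and e: "0 < e"
  shows "\<exists>\<delta>>0. \<forall>t. \<bar>t\<bar> < \<delta> \<longrightarrow> (\<exists>s. \<bar>s\<bar> \<le> e * \<bar>t\<bar> \<and> z + t *\<^sub>R v + s *\<^sub>R DF z \<in> W \<and> F (z + t *\<^sub>R v + s *\<^sub>R DF z) = 0)"
proof -
  define m where "m = norm (DF z)"
  have m: "0 < m" using D by (simp add: m_def)
  \<comment> \<open>For \<open>\<bar>s\<bar> \<le> e * \<bar>t\<bar>\<close> the displaced point
    lies within \<open>\<bar>t\<bar> * c\<close> of \<open>z\<close>. The choice of \<eta> then
    makes the linearisation error at most \<open>e * \<bar>t\<bar> * m\<^sup>2\<close>, the gain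
    from the gradient at the extreme values of \<open>s\<close>.\<close>
  define c where "c = norm v + e * m"
  have c: "0 < c" using e m by (simp add: c_def add_nonneg_pos)
  define \<eta> where "\<eta> = e * m\<^sup>2 / c"
  have \<eta>: "0 < \<eta>" "\<eta> * c = e * m\<^sup>2" using e m c by (auto simp: \<eta>_def)
  have "(F has_derivative (\<lambda>h. h \<bullet> DF z)) (at z)" using F[OF W(2)] by (simp add: gderiv_def)
  then obtain d1 where d1: "d1 > 0" "\<And>x. norm (x - z) < d1 \<Longrightarrow> \<bar>F x - F z - (x - z) \<bullet> DF z\<bar> \<le> \<eta> * norm (x - z)"
    unfolding has_derivative_at_alt using \<eta>(1) by (auto simp del: inner_diff_left)
  obtain d2 where d2: "d2 > 0" "ball z d2 \<subseteq> W" using W openE by metis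
  define \<delta> where "\<delta> = min d1 d2 / c"
  have "0 < \<delta>" using d1 d2 c by (simp add: \<delta>_def)
  moreover have "\<exists>s. \<bar>s\<bar> \<le> e * \<bar>t\<bar> \<and> z + t *\<^sub>R v + s *\<^sub>R DF z \<in> W \<and> F (z + t *\<^sub>R v + s *\<^sub>R DF z) = 0"
    if t: "\<bar>t\<bar> < \<delta>" for t
  proof -
    define \<gamma> where "\<gamma> s = z + t *\<^sub>R v + s *\<^sub>R DF z" for s
    have tc: "\<bar>t\<bar> * c < min d1 d2" using t c by (simp add: \<delta>_def pos_less_divide_eq)
    have near: "norm (\<gamma> s - z) \<le> \<bar>t\<bar> * c" if "\<bar>s\<bar> \<le> e * \<bar>t\<bar>" for s
    proof -
      have "norm (\<gamma> s - z) \<le> \<bar>t\<bar> * norm v + \<bar>s\<bar> * m"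
        unfolding \<gamma>_def m_def using norm_triangle_ineq[of "t *\<^sub>R v" "s *\<^sub>R DF z"] by (simp add: add.assoc)
      also have "\<bar>s\<bar> * m \<le> e * \<bar>t\<bar> * m" using that m by (intro mult_right_mono) auto
      finally show ?thesis by (simp add: c_def algebra_simps)
    qed
    have inW: "\<gamma> s \<in> W" if "\<bar>s\<bar> \<le> e * \<bar>t\<bar>" for s
      using near[OF that] tc d2(2) by (auto simp: dist_norm norm_minus_commute subset_iff)
    have slope: "\<bar>F (\<gamma> s) - s * m\<^sup>2\<bar> \<le> e * \<bar>t\<bar> * m\<^sup>2" if "\<bar>s\<bar> \<le> e * \<bar>t\<bar>" for s
    proof -
      have "(\<gamma> s - z) \<bullet> DF z = s * m\<^sup>2"
        using v by (simp add: \<gamma>_def m_def inner_add_left power2_norm_eq_inner)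
      moreover have "\<eta> * norm (\<gamma> s - z) \<le> \<eta> * (\<bar>t\<bar> * c)"
        using near[OF that] \<eta>(1) by (intro mult_left_mono) auto
      moreover have "\<eta> * (\<bar>t\<bar> * c) = e * \<bar>t\<bar> * m\<^sup>2" using \<eta>(2) by (simp add: algebra_simps)
      ultimately show ?thesis using d1(2)[of "\<gamma> s"] near[OF that] tc z by simp
    qed
    have T: "0 \<le> e * \<bar>t\<bar>" using e by simp
    have "\<exists>s. - (e * \<bar>t\<bar>) \<le> s \<and> s \<le> e * \<bar>t\<bar> \<and> (\<lambda>s. F (\<gamma> s)) s = 0"
    proof (rule IVT')
      show "F (\<gamma> (- (e * \<bar>t\<bar>))) \<le> 0" "0 \<le> F (\<gamma> (e * \<bar>t\<bar>))"
        using slope[of "- (e * \<bar>t\<bar>)"] slope[of "e * \<bar>t\<bar>"] T by (auto simp: abs_le_iff)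
      show "continuous_on {- (e * \<bar>t\<bar>)..e * \<bar>t\<bar>} (\<lambda>s. F (\<gamma> s))"
      proof (rule continuous_on_compose2[where f = \<gamma>])
        show "continuous_on W F"
          using F W(1) by (auto simp: gderiv_def continuous_on_eq_continuous_at intro: has_derivative_continuous)
        show "\<gamma> ` {- (e * \<bar>t\<bar>)..e * \<bar>t\<bar>} \<subseteq> W" using inW by (auto simp: abs_le_iff)
      qed (auto simp: \<gamma>_def intro!: continuous_intros)
    qed (use T in auto)
    then obtain s where "\<bar>s\<bar> \<le> e * \<bar>t\<bar>" "F (\<gamma> s) = 0" by (auto simp: abs_le_iff minus_le_iff)
    then show ?thesis using inW[of s] by (auto simp: \<gamma>_def)
  qed
  ultimately show ?thesis by blast
qed

text \<open>The zeros to be selected from lie in an open set and need not form a closed set, so the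
  least modulus may fail to be attained; a slack \<delta> replaces compactness.\<close>

lemma ex_almost_minimal_abs:
  fixes X :: "real set"
  assumes "X \<noteq> {}" "0 < \<delta>"
  shows "\<exists>s\<in>X. \<forall>s'\<in>X. \<bar>s\<bar> \<le> \<bar>s'\<bar> + \<delta>"
proof -
  have bb: "bdd_below (abs ` X)" by (rule bdd_belowI[of _ 0]) auto
  obtain s where "s \<in> X" "\<bar>s\<bar> < Inf (abs ` X) + \<delta>"
    using cInf_lessD[of "abs ` X" "Inf (abs ` X) + \<delta>"] assms by auto
  moreover have "Inf (abs ` X) \<le> \<bar>s'\<bar>" if "s' \<in> X" for s'
    by (rule cInf_lower[OF _ bb]) (use that in auto)
  ultimately show ?thesis by (intro bexI[of _ s]) force+
qed

text \<open>The curve adds to the tangent line a correction \<open>S t\<close> along the gradient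
  that returns it to \<Gamma>. \<open>tangent_space\<close> asks for a derivative at 0 only, so
  \<open>S\<close> may be an arbitrary, even discontinuous, choice of zeros as long as
  \<open>S t = o(t)\<close>.\<close>

lemma tangent_spaceI_gradient:
  fixes F :: "'a::real_inner \<Rightarrow> real"
  assumes W: "open W" "z \<in> W" and F: "\<And>x. x \<in> W \<Longrightarrow> GDERIV F x :> DF x"
    and D: "DF z \<noteq> 0" and \<Gamma>: "\<Gamma> \<inter> W = {x \<in> W. F x = 0}" "z \<in> \<Gamma>" and v: "v \<bullet> DF z = 0"
  shows "v \<in> tangent_space \<Gamma> z"
proof -
  define Z where "Z t = {s. z + t *\<^sub>R v + s *\<^sub>R DF z \<in> W \<and> F (z + t *\<^sub>R v + s *\<^sub>R DF z) = 0}" for t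
  have z: "F z = 0" using W \<Gamma> by auto
  have small: "\<exists>\<delta>>0. \<forall>t. \<bar>t\<bar> < \<delta> \<longrightarrow> (\<exists>s\<in>Z t. \<bar>s\<bar> \<le> e * \<bar>t\<bar>)" if "0 < e" for e
    using zero_near_tangent_line[OF W F D z v that] unfolding Z_def by blast
  \<comment> \<open>A zero of almost smallest modulus, which makes \<open>S t = o(t)\<close> although \<open>\<delta>\<close> depends on \<open>e\<close> in \<open>small\<close>.\<close>
  define S where "S t = (if t = 0 then 0 else SOME s. s \<in> Z t \<and> (\<forall>s'\<in>Z t. \<bar>s\<bar> \<le> \<bar>s'\<bar> + t\<^sup>2))" for t
  have S: "S t \<in> Z t \<and> (\<forall>s'\<in>Z t. \<bar>S t\<bar> \<le> \<bar>s'\<bar> + t\<^sup>2)" if "Z t \<noteq> {}" "t \<noteq> 0" for t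
  proof -
    have "\<exists>s. s \<in> Z t \<and> (\<forall>s'\<in>Z t. \<bar>s\<bar> \<le> \<bar>s'\<bar> + t\<^sup>2)"
      using ex_almost_minimal_abs[of "Z t" "t\<^sup>2"] that by auto
    from someI_ex[OF this] show ?thesis using that by (simp add: S_def)
  qed
  have S0: "(S has_real_derivative 0) (at 0)"
    unfolding DERIV_def
  proof (rule LIM_I)
    fix r :: real assume r: "0 < r"
    obtain \<delta> where \<delta>: "\<delta> > 0" "\<And>t. \<bar>t\<bar> < \<delta> \<Longrightarrow> \<exists>s\<in>Z t. \<bar>s\<bar> \<le> (r / 2) * \<bar>t\<bar>"
      using small[of "r / 2"] r by auto
    show "\<exists>s>0. \<forall>h. h \<noteq> 0 \<and> norm (h - 0) < s \<longrightarrow> norm ((S (0 + h) - S 0) / h - 0) < r"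
    \<comment> \<open>The competing zero \<open>s\<close> costs at most
      \<open>(r / 2) * \<bar>h\<bar>\<close>, and the slack \<open>h\<^sup>2\<close> less than the
      same amount.\<close>
    proof (intro exI[of _ "min \<delta> (r / 2)"] conjI allI impI)
      fix h :: real assume h: "h \<noteq> 0 \<and> norm (h - 0) < min \<delta> (r / 2)"
      then obtain s where s: "s \<in> Z h" "\<bar>s\<bar> \<le> (r / 2) * \<bar>h\<bar>" using \<delta>(2)[of h] by auto
      then have "\<bar>S h\<bar> \<le> (r / 2) * \<bar>h\<bar> + h\<^sup>2" using S[of h] h by force
      also have "h\<^sup>2 = \<bar>h\<bar> * \<bar>h\<bar>" by (simp add: power2_eq_square)
      also have "(r / 2) * \<bar>h\<bar> + \<bar>h\<bar> * \<bar>h\<bar> < (r / 2) * \<bar>h\<bar> + (r / 2) * \<bar>h\<bar>"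
        using h by (intro add_strict_left_mono mult_strict_right_mono) auto
      finally have "\<bar>S h\<bar> < r * \<bar>h\<bar>" by (simp add: algebra_simps)
      then show "norm ((S (0 + h) - S 0) / h - 0) < r"
        using h by (simp add: S_def[of 0] abs_divide pos_divide_less_eq)
    qed (use \<delta> r in auto)
  qed
  define \<gamma> where "\<gamma> t = z + t *\<^sub>R v + S t *\<^sub>R DF z" for t
  have "(\<gamma> has_vector_derivative v) (at 0)"
    unfolding \<gamma>_def using S0
    by (auto intro!: derivative_eq_intros simp: has_real_derivative_iff_has_vector_derivative[symmetric])
  moreover have "\<forall>\<^sub>F t in at 0. \<gamma> t \<in> \<Gamma>"
  proof -
    obtain \<delta> where "\<delta> > 0" "\<And>t. \<bar>t\<bar> < \<delta> \<Longrightarrow> \<exists>s\<in>Z t. \<bar>s\<bar> \<le> 1 * \<bar>t\<bar>" using small[of 1] by auto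
    then have "\<gamma> t \<in> \<Gamma>" if "t \<noteq> 0" "dist t 0 < \<delta>" for t
      using S[of t] that \<Gamma>(1) by (auto simp: Z_def \<gamma>_def)
    then show ?thesis unfolding eventually_at using \<open>\<delta> > 0\<close> by blast
  qed
  moreover have "\<gamma> 0 = z" by (simp add: \<gamma>_def S_def)
  ultimately show ?thesis unfolding tangent_space_def by blast
qed

lemma parallel_of_orthogonal_complement:
  fixes u D :: "'a::real_inner"
  assumes "\<And>v. v \<bullet> D = 0 \<Longrightarrow> u \<bullet> v = 0" "D \<noteq> 0"
  shows "\<exists>\<alpha>. u = \<alpha> *\<^sub>R D"
proof -
  define \<alpha> where "\<alpha> = (u \<bullet> D) / (D \<bullet> D)"
  define v where "v = u - \<alpha> *\<^sub>R D"
  have "v \<bullet> D = 0" using assms(2) by (simp add: v_def \<alpha>_def inner_diff_left)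
  moreover from assms(1)[OF this] have "u \<bullet> v = 0" .
  ultimately have "v \<bullet> v = 0" by (simp add: v_def inner_diff_left inner_commute)
  then show ?thesis by (auto simp: v_def)
qed

lemma space_surface_measure [simp]: "\<Gamma> \<in> sets borel \<Longrightarrow> space (surface_measure \<Gamma>) = \<Gamma>"
  by (simp add: surface_measure_def space_restrict_space)

lemma complete_measure_surface_measure: "complete_measure (surface_measure \<Gamma>)"
  unfolding surface_measure_def by (rule completion.complete_measure_axioms)

lemma measurable_surface_measure:
  "f \<in> borel_measurable borel \<Longrightarrow> f \<in> borel_measurable (surface_measure \<Gamma>)"
  unfolding surface_measure_def
  by (intro measurable_completion measurable_restrict_space1) (simp cong: measurable_cong_sets)

lemma null_sets_surface_measureI:
  fixes \<Gamma> :: "(real ^ 'n) set"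
  assumes "A \<in> null_sets (hausdorff_measure (CARD('n) - 1))" "A \<subseteq> \<Gamma>" "\<Gamma> \<in> sets borel"
  shows "A \<in> null_sets (surface_measure \<Gamma>)"
  unfolding surface_measure_def
  by (rule null_sets_completionI, subst null_sets_restrict_space) (use assms in auto)

lemma finite_measure_surface_measure:
  fixes \<Gamma> :: "(real ^ 'n) set"
  assumes card: "CARD('n) \<ge> 2" and \<Gamma>: "compact \<Gamma>" "C1_hypersurface \<Gamma>"
  shows "finite_measure (surface_measure \<Gamma>)"
proof
  have Gb: "\<Gamma> \<in> sets borel" using \<Gamma>(1) by (simp add: borel_compact)
  let ?H = "hausdorff_measure (CARD('n) - 1) :: (real ^ 'n) measure"
  have "\<forall>z\<in>\<Gamma>. \<exists>r>0. hausdorff_outer (CARD('n) - 1) (\<Gamma> \<inter> ball z r) < \<infinity>"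
    using C1_hypersurface_locally_finite[OF card \<Gamma>(2)] by blast
  then obtain r where r: "\<And>z. z \<in> \<Gamma> \<Longrightarrow> r z > 0"
      "\<And>z. z \<in> \<Gamma> \<Longrightarrow> hausdorff_outer (CARD('n) - 1) (\<Gamma> \<inter> ball z (r z)) < \<infinity>" by metis
  obtain T where T: "T \<subseteq> \<Gamma>" "finite T" "\<Gamma> \<subseteq> (\<Union>z\<in>T. ball z (r z))"
    using compactE_image[OF \<Gamma>(1), of \<Gamma> "\<lambda>z. ball z (r z)"] r(1) by force
  have "emeasure ?H \<Gamma> \<le> emeasure ?H (\<Union>z\<in>T. \<Gamma> \<inter> ball z (r z))"
    using T Gb by (intro emeasure_mono) (auto intro!: sets.finite_UN)
  also have "\<dots> \<le> (\<Sum>z\<in>T. emeasure ?H (\<Gamma> \<inter> ball z (r z)))"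
    using T Gb by (intro emeasure_subadditive_finite) auto
  also have "\<dots> < \<infinity>"
  proof -
    have "emeasure ?H (\<Gamma> \<inter> ball z (r z)) < \<infinity>" if "z \<in> T" for z
      using r(2)[of z] that T(1) Gb by (subst emeasure_hausdorff_measure) auto
    then show ?thesis using T(2) by (simp add: ennreal_sum_less_top)
  qed
  finally have "emeasure ?H \<Gamma> < \<infinity>" .
  moreover have "emeasure (surface_measure \<Gamma>) (space (surface_measure \<Gamma>)) = emeasure ?H \<Gamma>"
  proof -
    have G: "\<Gamma> \<in> sets (restrict_space ?H \<Gamma>)" using Gb by (auto simp: sets_restrict_space)
    have "emeasure (surface_measure \<Gamma>) \<Gamma> = emeasure (restrict_space ?H \<Gamma>) \<Gamma>"
      unfolding surface_measure_def using G by simp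
    also have "\<dots> = emeasure ?H \<Gamma>" using Gb by (intro emeasure_restrict_space) auto
    finally show ?thesis using Gb by simp
  qed
  ultimately show "emeasure (surface_measure \<Gamma>) (space (surface_measure \<Gamma>)) \<noteq> \<infinity>" by auto
qed

text \<open>The curves of \<open>tangent_spaceI_gradient\<close> force \<open>\<nu> z\<close> to be
  a multiple of \<open>DF z\<close>. Were \<open>DF z\<close> in turn a multiple of
  \<open>k\<close>, then \<open>z\<close> would lie in \<open>R\<close>; so outside \<open>R\<close>
  some minor is nonzero and the local result applies.\<close>

lemma surface_measure_level_null:
  fixes \<Gamma> :: "(real ^ 'n) set"
  assumes \<Gamma>: "compact \<Gamma>" "C1_hypersurface \<Gamma>" and \<nu>: "unit_normal_mapping \<Gamma> \<nu>" "IDDC \<Gamma> \<nu>"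
    and k: "k \<in> integer_vectors" "k \<noteq> 0" and N: "N \<in> null_sets lborel"
  shows "{x \<in> \<Gamma>. k \<bullet> x \<in> N} \<in> null_sets (surface_measure \<Gamma>)"
proof -
  have Gb: "\<Gamma> \<in> sets borel" using \<Gamma>(1) by (simp add: borel_compact)
  let ?H = "hausdorff_measure (CARD('n) - 1) :: (real ^ 'n) measure"
  define R where "R = {z \<in> \<Gamma>. rational_direction (\<nu> z)}"
  have R: "R \<in> null_sets (surface_measure \<Gamma>)" using \<nu>(2) by (simp add: R_def IDDC_def)
  have "\<exists>r>0. \<Gamma> \<inter> ball z r \<inter> {x. k \<bullet> x \<in> N} \<in> null_sets ?H" if z: "z \<in> \<Gamma> - R" for z
  proof -
    have zG: "z \<in> \<Gamma>" using z by simp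
    obtain W F DF where W: "open W" "z \<in> W" "\<And>x. x \<in> W \<Longrightarrow> GDERIV F x :> DF x" "continuous_on W DF"
      "DF z \<noteq> 0" "\<Gamma> \<inter> W = {x \<in> W. F x = 0}"
      using \<Gamma>(2) zG by (rule C1_hypersurfaceE) blast
    have "\<exists>i j. DF z $ i * k $ j \<noteq> DF z $ j * k $ i"
    proof (rule ccontr)
      assume "\<nexists>i j. DF z $ i * k $ j \<noteq> DF z $ j * k $ i"
      then obtain \<alpha> where \<alpha>: "DF z = \<alpha> *\<^sub>R k" using parallel_of_minors_vec[of "DF z" k] k(2) by blast
      have "\<nu> z \<bullet> v = 0" if "v \<bullet> DF z = 0" for v
        using tangent_spaceI_gradient[OF W(1-3) W(5,6) zG that] \<nu>(1) zG
        by (auto simp: unit_normal_mapping_def)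
      then obtain \<beta> where "\<nu> z = \<beta> *\<^sub>R DF z" using parallel_of_orthogonal_complement[OF _ W(5)] by blast
      then have "\<nu> z = (\<beta> * \<alpha>) *\<^sub>R k" using \<alpha> by simp
      moreover have "norm (\<nu> z) = 1" using \<nu>(1) zG by (simp add: unit_normal_mapping_def)
      ultimately have "rational_direction (\<nu> z)" using k(1) unfolding rational_direction_def by blast
      then show False using z by (simp add: R_def)
    qed
    then show ?thesis using C1_hypersurface_level_null[OF W(1-4,6) _ Gb N] by blast
  qed
  then obtain r where r: "\<And>z. z \<in> \<Gamma> - R \<Longrightarrow> r z > 0"
      "\<And>z. z \<in> \<Gamma> - R \<Longrightarrow> \<Gamma> \<inter> ball z (r z) \<inter> {x. k \<bullet> x \<in> N} \<in> null_sets ?H" by metis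
  \<comment> \<open>\<open>\<Gamma> - R\<close> need not be compact and the radii may shrink to 0,
    so a countable subcover takes the place of a finite one; for null sets this suffices.\<close>
  obtain \<F> where \<F>: "\<F> \<subseteq> (\<lambda>z. ball z (r z)) ` (\<Gamma> - R)" "countable \<F>"
      "\<Union>\<F> = (\<Union>z\<in>\<Gamma> - R. ball z (r z))"
    using Lindelof[of "(\<lambda>z. ball z (r z)) ` (\<Gamma> - R)"] by blast
  define U where "U = (\<Union>B\<in>\<F>. \<Gamma> \<inter> B \<inter> {x. k \<bullet> x \<in> N})"
  have "U \<in> null_sets ?H" unfolding U_def
  proof (rule null_sets_UN'[OF \<F>(2)])
    fix B assume "B \<in> \<F>"
    then show "\<Gamma> \<inter> B \<inter> {x. k \<bullet> x \<in> N} \<in> null_sets ?H" using \<F>(1) r(2) by auto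
  qed
  then have U: "U \<in> null_sets (surface_measure \<Gamma>)"
    by (rule null_sets_surface_measureI[OF _ _ Gb]) (auto simp: U_def)
  have "{x \<in> \<Gamma>. k \<bullet> x \<in> N} \<subseteq> R \<union> U"
  proof
    fix x assume x: "x \<in> {x \<in> \<Gamma>. k \<bullet> x \<in> N}"
    show "x \<in> R \<union> U"
    proof (cases "x \<in> R")
      case False
      then have "x \<in> ball x (r x)" using r(1) x by auto
      then have "x \<in> \<Union>\<F>" using False x \<F>(3) by blast
      then show ?thesis using x by (auto simp: U_def)
    qed simp
  qed
  then show ?thesis
    using complete_measure.complete2[OF complete_measure_surface_measure] R U by blast
qed

section \<open>The Riemann-Lebesgue lemma\<close>

lemma integrable_mult_cos:
  fixes f u :: "'a \<Rightarrow> real"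
  assumes "integrable M f" "u \<in> borel_measurable M"
  shows "integrable M (\<lambda>x. f x * cos (u x))"
proof (rule Bochner_Integration.integrable_bound[OF assms(1)])
  show "AE x in M. norm (f x * cos (u x)) \<le> norm (f x)"
    by (auto simp: abs_mult intro!: mult_left_le)
qed (use assms in measurable)

text \<open>Since the cosine is bounded by 1, replacing \<open>f\<close> by \<open>F n\<close>
  changes the integral by at most their L1-distance, uniformly in \<open>s\<close>. The decay
  property is therefore closed under dominated limits.\<close>

lemma Riemann_Lebesgue_dominated:
  fixes f :: "real \<Rightarrow> real"
  assumes F: "\<And>n. integrable lborel (F n)" and f: "f \<in> borel_measurable lborel"
    and lim: "\<And>t. (\<lambda>n. F n t) \<longlonglongrightarrow> f t"
    and w: "integrable lborel w" "\<And>n t. \<bar>F n t\<bar> \<le> w t"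
    and RL: "\<And>n. ((\<lambda>s. LINT t|lborel. F n t * cos (s * t + c)) \<longlongrightarrow> 0) at_infinity"
  shows "((\<lambda>s. LINT t|lborel. f t * cos (s * t + c)) \<longlongrightarrow> 0) at_infinity"
proof (rule tendstoI)
  fix e :: real assume e: "0 < e"
  have fw: "\<bar>f t\<bar> \<le> w t" for t
    using lim[of t] w(2) by (intro tendsto_upperbound[OF tendsto_rabs]) auto
  have fi: "integrable lborel f"
    by (rule Bochner_Integration.integrable_bound[OF w(1) f]) (use fw in \<open>auto intro: order_trans[OF _ abs_ge_self]\<close>)
  have "(\<lambda>n. LINT t|lborel. \<bar>F n t - f t\<bar>) \<longlonglongrightarrow> (LINT t|(lborel :: real measure). (0::real))"
  proof (rule integral_dominated_convergence)
    show "integrable lborel (\<lambda>t. 2 * w t)" using w by auto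
    show "AE t in lborel. (\<lambda>n. \<bar>F n t - f t\<bar>) \<longlonglongrightarrow> 0"
      by (rule AE_I2) (intro tendsto_rabs_zero LIM_zero lim)
    show "AE t in lborel. norm \<bar>F n t - f t\<bar> \<le> 2 * w t" for n
    proof (rule AE_I2)
      fix t show "norm \<bar>F n t - f t\<bar> \<le> 2 * w t" using w(2)[of n t] fw[of t] by simp
    qed
  qed (use F f in auto)
  then obtain n where n: "(LINT t|lborel. \<bar>F n t - f t\<bar>) < e / 2"
    using e order_tendstoD(2)[of _ 0 sequentially "e / 2"] by (fastforce simp: eventually_sequentially)
  have diff: "\<bar>(LINT t|lborel. f t * cos (s * t + c)) - (LINT t|lborel. F n t * cos (s * t + c))\<bar> < e / 2" for s
  proof -
    have "(LINT t|lborel. f t * cos (s * t + c)) - (LINT t|lborel. F n t * cos (s * t + c))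
       = (LINT t|lborel. (f t - F n t) * cos (s * t + c))"
      by (subst Bochner_Integration.integral_diff[symmetric])
        (auto intro!: integrable_mult_cos F fi simp: algebra_simps)
    also have "\<bar>\<dots>\<bar> \<le> (LINT t|lborel. \<bar>F n t - f t\<bar>)"
    proof (rule order_trans[OF integral_abs_bound], rule integral_mono)
      show "integrable lborel (\<lambda>t. \<bar>(f t - F n t) * cos (s * t + c)\<bar>)"
        by (intro integrable_abs integrable_mult_cos Bochner_Integration.integrable_diff F fi) simp
      show "\<bar>(f t - F n t) * cos (s * t + c)\<bar> \<le> \<bar>F n t - f t\<bar>" for t
        by (simp add: abs_mult abs_minus_commute mult_left_le)
    qed (use F fi in auto)
    finally show ?thesis using n by simp
  qed
  from tendstoD[OF RL[of n], of "e / 2"] e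
  have "\<forall>\<^sub>F s in at_infinity. \<bar>LINT t|lborel. F n t * cos (s * t + c)\<bar> < e / 2" by simp
  then show "\<forall>\<^sub>F s in at_infinity. dist (LINT t|lborel. f t * cos (s * t + c)) 0 < e"
  proof eventually_elim
    case (elim s) then show ?case using diff[of s] unfolding dist_real_def by linarith
  qed
qed

lemma Riemann_Lebesgue_interval:
  fixes a b c :: real
  shows "((\<lambda>s. LINT t|lborel. indicator {a..b} t * cos (s * t + c)) \<longlongrightarrow> 0) at_infinity"
proof (cases "a \<le> b")
  case ab: True
  have val: "(LINT t|lborel. indicator {a..b} t * cos (s * t + c)) = (sin (s * b + c) - sin (s * a + c)) / s"
    if "s \<noteq> 0" for s
  proof -
    have "(LINT t|lborel. cos (s * t + c) * indicator {a..b} t) = sin (s * b + c) / s - sin (s * a + c) / s"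
      by (rule integral_FTC_Icc_real[OF ab]) (use that in \<open>auto intro!: derivative_eq_intros\<close>)
    then show ?thesis by (simp add: mult.commute diff_divide_distrib)
  qed
  show ?thesis
  proof (rule Lim_null_comparison)
    show "((\<lambda>s. 2 * norm (inverse s :: real)) \<longlongrightarrow> 0) at_infinity"
      by (rule tendsto_mult_right_zero[OF tendsto_norm_zero[OF tendsto_inverse_0]])
    have "\<forall>\<^sub>F s in at_infinity. s \<noteq> (0::real)"
      unfolding eventually_at_infinity by (intro exI[of _ 1]) auto
    then show "\<forall>\<^sub>F s in at_infinity. norm (LINT t|lborel. indicator {a..b} t * cos (s * t + c)) \<le> 2 * norm (inverse s)"
    proof eventually_elim
      case (elim s)
      have "\<bar>sin (s * b + c) - sin (s * a + c)\<bar> \<le> 2"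
        using abs_triangle_ineq4[of "sin (s * b + c)" "sin (s * a + c)"] abs_sin_le_one[of "s * b + c"] abs_sin_le_one[of "s * a + c"]
        by linarith
      then have "\<bar>sin (s * b + c) - sin (s * a + c)\<bar> / \<bar>s\<bar> \<le> 2 / \<bar>s\<bar>" by (rule divide_right_mono) simp
      then show ?case using elim by (simp add: val divide_inverse abs_mult)
    qed
  qed
qed simp

text \<open>Closed intervals generate the Borel sets and are stable under intersection, so the decay
  extends through complements and countable disjoint unions. Complements may have infinite measure,
  hence everything is first cut down to \<open>{-r..r}\<close>, and \<open>r\<close> is sent to
  infinity at the end.\<close>

lemma Riemann_Lebesgue_indicator:
  assumes A: "A \<in> sets (borel :: real measure)" "emeasure lborel A < \<infinity>"
  shows "((\<lambda>s. LINT t|lborel. indicator A t * cos (s * t + c)) \<longlongrightarrow> 0) at_infinity"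
proof -
  let ?RL = "\<lambda>B. ((\<lambda>s. LINT t|lborel. indicator B t * cos (s * t + c)) \<longlongrightarrow> 0) at_infinity"
  have ind: "integrable lborel (indicator B :: real \<Rightarrow> real)" if "B \<in> sets borel" "emeasure lborel B < \<infinity>" for B
    using that by simp
  have bounded_part: "?RL (B \<inter> {-r..r})" if B: "B \<in> sets borel" for B and r :: real
  proof -
    let ?G = "range (\<lambda>(a, b). {a..b :: real})"
    have gen: "sets borel = sigma_sets UNIV ?G" by (subst borel_eq_atLeastAtMost) simp
    have fin: "emeasure lborel (C \<inter> {-r..r}) < \<infinity>" if "C \<in> sets borel" for C
    proof -
      have "emeasure lborel (C \<inter> {-r..r}) \<le> emeasure lborel {-r..r}" by (intro emeasure_mono) auto
      also have "\<dots> < \<infinity>" by (simp add: emeasure_lborel_Icc_eq)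
      finally show ?thesis .
    qed
    have IS: "Int_stable ?G" "?G \<subseteq> Pow UNIV"
    proof -
      have "{a..b} \<inter> {c..d} = {max a c..min b d}" for a b c d :: real by auto
      then show "Int_stable ?G" unfolding Int_stable_def by auto
    qed auto
    from B have "B \<in> sigma_sets UNIV ?G" by (simp only: gen)
    with IS show ?thesis
    proof (induction rule: sigma_sets_induct_disjoint)
      case (basic C)
      then obtain a b where "C = {a..b}" by auto
      then have "C \<inter> {-r..r} = {max a (-r)..min b r}" by auto
      then show ?case by (simp only: Riemann_Lebesgue_interval)
    next
      case empty then show ?case by simp
    next
      case (compl C)
      then have C: "C \<in> sets borel" by (simp only: gen)
      have "(LINT t|lborel. indicator ((UNIV - C) \<inter> {-r..r}) t * cos (s * t + c)) =
          (LINT t|lborel. indicator {-r..r} t * cos (s * t + c)) - (LINT t|lborel. indicator (C \<inter> {-r..r}) t * cos (s * t + c))" for s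
        using fin[of UNIV] fin[OF C] C
        by (subst Bochner_Integration.integral_diff[symmetric])
          (auto intro!: integrable_mult_cos ind Bochner_Integration.integral_cong split: split_indicator simp: emeasure_lborel_Icc_eq)
      then show ?case
        using tendsto_diff[OF Riemann_Lebesgue_interval compl.IH] by simp
    next
      case (union C)
      then have C: "C n \<in> sets borel" for n by (auto simp only: gen)
      \<comment> \<open>Finite unions are handled by additivity of indicators of disjoint sets; the
        countable union is their dominated limit.\<close>
      define U where "U n = (\<Union>i<n. C i) \<inter> {-r..r}" for n
      have Ub: "U n \<in> sets borel" for n using C by (auto simp: U_def)
      show ?case
      proof (rule Riemann_Lebesgue_dominated[where F = "\<lambda>n. indicator (U n)" and w = "indicator {-r..r}"])
        show "integrable lborel (indicator (U n) :: real \<Rightarrow> real)" for n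
          using Ub fin[of "\<Union>i<n. C i"] C by (intro ind) (auto simp: U_def)
        show "(\<lambda>n. indicator (U n) t :: real) \<longlonglongrightarrow> indicator ((\<Union>i. C i) \<inter> {-r..r}) t" for t
        proof -
          have "(\<lambda>n. indicator (\<Union>i<n. C i \<inter> {-r..r}) t :: real) \<longlonglongrightarrow> indicator (\<Union>i. C i \<inter> {-r..r}) t"
            by (rule LIMSEQ_indicator_UN)
          then show ?thesis by (simp add: U_def)
        qed
        show "((\<lambda>s. LINT t|lborel. indicator (U n) t * cos (s * t + c)) \<longlongrightarrow> 0) at_infinity" for n
        proof -
          have "indicator (U n) t = (\<Sum>i<n. indicator (C i \<inter> {-r..r}) t :: real)" for t
          proof -
            have "disjoint_family_on (\<lambda>i. C i \<inter> {-r..r}) {..<n}"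
              using union by (auto simp: disjoint_family_on_def)
            moreover have "U n = (\<Union>i\<in>{..<n}. C i \<inter> {-r..r})" by (auto simp: U_def)
            ultimately show ?thesis by (simp only: indicator_UN_disjoint[OF finite_lessThan])
          qed
          then have "(LINT t|lborel. indicator (U n) t * cos (s * t + c)) =
              (\<Sum>i<n. LINT t|lborel. indicator (C i \<inter> {-r..r}) t * cos (s * t + c))" for s
            using C fin by (subst Bochner_Integration.integral_sum[symmetric])
              (auto intro!: integrable_mult_cos ind simp: sum_distrib_right)
          then show ?thesis using tendsto_sum[of "{..<n}" _ "\<lambda>_. 0", OF union.IH] by simp
        qed
        show "integrable lborel (indicator {-r..r} :: real \<Rightarrow> real)" by (intro ind) (auto simp: emeasure_lborel_Icc_eq)
        show "\<bar>indicator (U n) t\<bar> \<le> (indicator {-r..r} t :: real)" for n t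
          by (auto simp: U_def split: split_indicator)
      qed (use C in auto)
    qed
  qed
  show ?thesis
  proof (rule Riemann_Lebesgue_dominated[where F = "\<lambda>n. indicator (A \<inter> {-real n..real n})" and w = "indicator A"])
    show "(\<lambda>n. indicator (A \<inter> {-real n..real n}) t :: real) \<longlonglongrightarrow> indicator A t" for t
    proof (rule tendsto_eventually)
      obtain m where m: "\<bar>t\<bar> \<le> real m" using real_arch_simple by blast
      show "\<forall>\<^sub>F n in sequentially. (indicator (A \<inter> {-real n..real n}) t :: real) = indicator A t"
        unfolding eventually_sequentially
        by (rule exI[of _ m]) (use m in \<open>auto split: split_indicator\<close>)
    qed
    show "integrable lborel (indicator (A \<inter> {-real n..real n}) :: real \<Rightarrow> real)" for n
    proof (rule ind)
      show "emeasure lborel (A \<inter> {-real n..real n}) < \<infinity>"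
        using A by (intro le_less_trans[OF emeasure_mono A(2)]) auto
    qed (use A in auto)
  qed (use A ind bounded_part in \<open>auto split: split_indicator\<close>)
qed

theorem Riemann_Lebesgue:
  fixes f :: "real \<Rightarrow> real"
  assumes "integrable lborel f"
  shows "((\<lambda>s. LINT t|lborel. f t * cos (s * t + c)) \<longlongrightarrow> 0) at_infinity"
  using assms
proof (induction rule: integrable_induct)
  case (base A a)
  have "((\<lambda>s. a * (LINT t|lborel. indicator A t * cos (s * t + c))) \<longlongrightarrow> 0) at_infinity"
    using Riemann_Lebesgue_indicator[of A c] base by (intro tendsto_mult_right_zero) auto
  then show ?case by (simp add: ac_simps)
next
  case (add f g)
  have "(LINT t|lborel. (f t + g t) * cos (s * t + c)) =
      (LINT t|lborel. f t * cos (s * t + c)) + (LINT t|lborel. g t * cos (s * t + c))" for s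
    using add.hyps by (subst Bochner_Integration.integral_add[symmetric])
      (auto intro!: integrable_mult_cos simp: algebra_simps)
  then show ?case using tendsto_add[OF add.IH] by simp
next
  case (lim f F)
  show ?case
    by (rule Riemann_Lebesgue_dominated[where F = F and w = "\<lambda>t. 2 * \<bar>f t\<bar>"]) (use lim in auto)
qed

text \<open>If \<open>f\<close> pushes \<open>M\<close> forward to a measure absolutely continuous with respect to
  Lebesgue measure, then the oscillating integrals are Fourier transforms of a Radon-Nikodym density.\<close>

theorem Riemann_Lebesgue_pushforward:
  fixes f h :: "'a \<Rightarrow> real"
  assumes M: "finite_measure M" and f: "f \<in> borel_measurable M"
    and null: "\<And>N. N \<in> null_sets lborel \<Longrightarrow> f -` N \<inter> space M \<in> null_sets M"
    and h: "integrable M h"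
  shows "((\<lambda>s. LINT x|M. h x * cos (s * f x + c)) \<longlongrightarrow> 0) at_infinity"
proof -
  \<comment> \<open>\<open>density M h\<close> represents \<open>h\<close> only where
    \<open>h\<close> is nonnegative; the general case takes positive and negative parts.\<close>
  have nonneg_case: "((\<lambda>s. LINT x|M. h x * cos (s * f x + c)) \<longlongrightarrow> 0) at_infinity"
    if h: "integrable M h" "\<And>x. 0 \<le> h x" for h
  proof -
    have hm: "h \<in> borel_measurable M" using h by auto
    define \<mu> where "\<mu> = distr (density M (\<lambda>x. ennreal (h x))) lborel f"
    have fm: "f \<in> density M (\<lambda>x. ennreal (h x)) \<rightarrow>\<^sub>M lborel" using f by simp
    have "emeasure \<mu> (space \<mu>) = (\<integral>\<^sup>+x. ennreal (h x) \<partial>M)"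
    proof -
      have "f -` UNIV \<inter> space M = space M" by auto
      then have "emeasure \<mu> (space \<mu>) = emeasure (density M (\<lambda>x. ennreal (h x))) (space M)"
        unfolding \<mu>_def by (subst emeasure_distr[OF fm]) auto
      also have "\<dots> = (\<integral>\<^sup>+x. ennreal (h x) * indicator (space M) x \<partial>M)"
        using hm by (intro emeasure_density) auto
      also have "\<dots> = (\<integral>\<^sup>+x. ennreal (h x) \<partial>M)" by (intro nn_integral_cong) auto
      finally show ?thesis .
    qed
    also have "\<dots> < \<infinity>" using h by (simp add: nn_integral_eq_integral)
    finally have fin: "emeasure \<mu> (space \<mu>) < \<infinity>" .
    then have fm\<mu>: "finite_measure \<mu>" by (intro finite_measureI) auto
    have s\<mu>: "sets \<mu> = sets lborel" by (simp add: \<mu>_def)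
    have ac: "absolutely_continuous lborel \<mu>"
      unfolding absolutely_continuous_def
    proof
      fix N :: "real set" assume N: "N \<in> null_sets lborel"
      have "f -` N \<inter> space M \<in> null_sets (density M (\<lambda>x. ennreal (h x)))"
        using absolutely_continuousI_density[of "\<lambda>x. ennreal (h x)" M] null[OF N] hm
        by (auto simp: absolutely_continuous_def)
      then show "N \<in> null_sets \<mu>"
        unfolding \<mu>_def using N by (subst null_sets_distr_iff[OF fm]) auto
    qed
    obtain D where D: "D \<in> borel_measurable lborel" "AE x in lborel. RN_deriv lborel \<mu> x = ennreal (D x)" "\<And>x. 0 \<le> D x"
      using sigma_finite_measure.real_RN_deriv[OF sigma_finite_lborel fm\<mu> ac s\<mu>] by metis
    have dens: "density lborel (\<lambda>x. ennreal (D x)) = \<mu>"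
    proof -
      have "density lborel (\<lambda>x. ennreal (D x)) = density lborel (RN_deriv lborel \<mu>)"
        using D by (intro density_cong) auto
      then show ?thesis
        using sigma_finite_measure.density_RN_deriv[OF sigma_finite_lborel ac s\<mu>] by simp
    qed
    have Dint: "integrable lborel D"
    proof (rule integrableI_nonneg)
      have "(\<integral>\<^sup>+x. ennreal (D x) \<partial>lborel) = emeasure \<mu> (space \<mu>)"
        unfolding dens[symmetric] using D(1) by (subst emeasure_density) auto
      then show "(\<integral>\<^sup>+x. ennreal (D x) \<partial>lborel) < \<infinity>" using fin by simp
    qed (use D in auto)
    have "(LINT x|M. h x * cos (s * f x + c)) = (LINT t|lborel. D t * cos (s * t + c))" for s
    proof -
      have "(LINT t|lborel. D t * cos (s * t + c)) = (LINT t|density lborel (\<lambda>x. ennreal (D x)). cos (s * t + c))"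
        using D by (subst integral_density) auto
      also have "\<dots> = (LINT x|density M (\<lambda>x. ennreal (h x)). cos (s * f x + c))"
        unfolding dens \<mu>_def by (rule integral_distr[OF fm]) simp
      also have "\<dots> = (LINT x|M. h x * cos (s * f x + c))"
        using h hm f by (subst integral_density) auto
      finally show ?thesis by simp
    qed
    then show ?thesis using Riemann_Lebesgue[OF Dint, of c] by simp
  qed
  have hp: "integrable M (\<lambda>x. max 0 (h x))" "integrable M (\<lambda>x. max 0 (- h x))" using h by auto
  have u: "(\<lambda>x. s * f x + c) \<in> borel_measurable M" for s using f by auto
  have "(LINT x|M. h x * cos (s * f x + c)) =
      (LINT x|M. max 0 (h x) * cos (s * f x + c)) - (LINT x|M. max 0 (- h x) * cos (s * f x + c))" for s
  proof -
    have "h x * cos (s * f x + c) = max 0 (h x) * cos (s * f x + c) - max 0 (- h x) * cos (s * f x + c)" for x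
      by (simp add: max_def)
    then show ?thesis
      using Bochner_Integration.integral_diff[OF integrable_mult_cos[OF hp(1) u] integrable_mult_cos[OF hp(2) u]] by simp
  qed
  then show ?thesis
    using tendsto_diff[OF nonneg_case[OF hp(1)] nonneg_case[OF hp(2)]] by simp
qed

section \<open>Integration over the torus\<close>

lemma unit_cell_measurable [measurable]: "{y :: real ^ 'n. \<forall>i. 0 \<le> y $ i \<and> y $ i < 1} \<in> sets borel"
proof -
  have "{y :: real ^ 'n. \<forall>i. 0 \<le> y $ i \<and> y $ i < 1} = (\<Inter>i. {y. 0 \<le> y $ i} \<inter> {y. y $ i < 1})" by auto
  also have "\<dots> \<in> sets borel"
  proof (rule sets.finite_INT)
    fix i :: 'n
    have "closed {y :: real ^ 'n. 0 \<le> y $ i}" "open {y :: real ^ 'n. y $ i < 1}"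
      by (auto intro!: closed_Collect_le open_Collect_less continuous_intros)
    then show "{y :: real ^ 'n. 0 \<le> y $ i} \<inter> {y. y $ i < 1} \<in> sets borel" by auto
  qed auto
  finally show ?thesis .
qed

lemma space_torus_measure: "space torus_measure = {y. \<forall>i. 0 \<le> y $ i \<and> y $ i < 1}"
  by (simp add: torus_measure_def space_restrict_space)

lemma measurable_torus_measure:
  "f \<in> borel_measurable borel \<Longrightarrow> f \<in> borel_measurable torus_measure"
  unfolding torus_measure_def by (intro measurable_restrict_space1) simp

lemma integral_torus_measure:
  fixes f :: "real ^ 'n \<Rightarrow> 'b::{banach, second_countable_topology}"
  shows "(LINT y|torus_measure. f y) = (LINT y|lborel. indicator {y. \<forall>i. 0 \<le> y $ i \<and> y $ i < 1} y *\<^sub>R f y)"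
  unfolding torus_measure_def by (rule integral_restrict_space) simp

lemma emeasure_space_torus_measure: "emeasure (torus_measure :: (real ^ 'n) measure) (space torus_measure) = 1"
proof -
  let ?U = "{y :: real ^ 'n. \<forall>i. 0 \<le> y $ i \<and> y $ i < 1}"
  have "emeasure (torus_measure :: (real ^ 'n) measure) (space torus_measure) = emeasure lborel ?U"
    unfolding space_torus_measure unfolding torus_measure_def by (rule emeasure_restrict_space) auto
  also have "\<dots> = 1"
  proof (rule antisym)
    have "?U \<subseteq> cbox 0 1" by (auto simp: mem_box_cart less_imp_le)
    then have "emeasure lborel ?U \<le> emeasure lborel (cbox (0 :: real ^ 'n) 1)" by (intro emeasure_mono) auto
    also have "\<dots> = 1" by (subst emeasure_lborel_cbox) (auto simp: Basis_vec_def inner_axis intro!: prod.neutral)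
    finally show "emeasure lborel ?U \<le> 1" .
    have "box 0 1 \<subseteq> ?U" by (auto simp: mem_box_cart less_imp_le)
    then have "emeasure lborel (box (0 :: real ^ 'n) 1) \<le> emeasure lborel ?U" by (intro emeasure_mono) auto
    moreover have "emeasure lborel (box (0 :: real ^ 'n) 1) = 1"
      by (subst emeasure_lborel_box) (auto simp: Basis_vec_def inner_axis intro!: prod.neutral)
    ultimately show "1 \<le> emeasure lborel ?U" by simp
  qed
  finally show ?thesis .
qed

lemma finite_measure_torus_measure: "finite_measure (torus_measure :: (real ^ 'n) measure)"
  by (rule finite_measureI) (simp add: emeasure_space_torus_measure)

lemma measure_space_torus_measure [simp]: "measure (torus_measure :: (real ^ 'n) measure) (space torus_measure) = 1"
  by (simp add: measure_def emeasure_space_torus_measure)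

text \<open>Fubini in coordinate form. It is complex-valued because the exponential of
  \<open>\<i> * (k \<bullet> y)\<close>, unlike the cosine of \<open>k \<bullet> y\<close>, factors
  over the coordinates.\<close>

lemma lborel_integral_prod_inner:
  fixes g :: "'a::euclidean_space \<Rightarrow> real \<Rightarrow> complex"
  assumes "\<And>b. b \<in> Basis \<Longrightarrow> integrable lborel (g b)"
  shows "(LINT y|lborel. (\<Prod>b\<in>Basis. g b (y \<bullet> b))) = (\<Prod>b\<in>Basis. LINT t|lborel. g b t)"
proof -
  interpret product_sigma_finite "\<lambda>b::'a. lborel :: real measure" by standard
  have [measurable]: "b \<in> Basis \<Longrightarrow> g b \<in> borel_measurable borel" for b
    using borel_measurable_integrable[OF assms[of b]] by simp
  have "(LINT y|lborel. (\<Prod>b\<in>Basis. g b (y \<bullet> b))) =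
      (LINT x|(\<Pi>\<^sub>M b\<in>Basis. lborel). (\<Prod>b\<in>Basis. g b ((\<Sum>b\<in>Basis. x b *\<^sub>R b) \<bullet> b)))"
    by (subst lborel_eq, rule integral_distr) measurable
  also have "\<dots> = (LINT x|(\<Pi>\<^sub>M b\<in>Basis. lborel). (\<Prod>b\<in>Basis. g b (x b)))"
    by (intro Bochner_Integration.integral_cong prod.cong) (auto simp: inner_sum_left_Basis)
  also have "\<dots> = (\<Prod>b\<in>Basis. LINT t|lborel. g b t)"
    by (rule product_integral_prod) (use assms in auto)
  finally show ?thesis .
qed

text \<open>A coordinate with \<open>k $ j \<noteq> 0\<close> contributes the integral of a complex
  exponential over full periods, which is 0. The phase \<open>c\<close> is a constant factor of the
  exponential, and the real part is taken last.\<close>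

lemma integral_torus_character:
  fixes k :: "real ^ 'n"
  assumes k: "k \<in> integer_vectors" "k \<noteq> 0"
  shows "(LINT y|torus_measure. cos (2 * pi * (k \<bullet> y) + c)) = 0"
proof -
  let ?U = "{y :: real ^ 'n. \<forall>i. 0 \<le> y $ i \<and> y $ i < 1}"
  define g where "g b t = indicator {0..<1} t *\<^sub>R exp (\<i> * complex_of_real (2 * pi * (k \<bullet> b) * t))" for b :: "real ^ 'n" and t
  have gi: "integrable lborel (g b)" for b
  proof (rule Bochner_Integration.integrable_bound)
    show "integrable lborel (indicator {0..<1::real} :: real \<Rightarrow> real)" by simp
    show "AE t in lborel. norm (g b t) \<le> norm (indicator {0..<1} t :: real)"
      by (rule AE_I2) (simp add: g_def split: split_indicator)
    show "g b \<in> borel_measurable lborel"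
      unfolding g_def by (intro borel_measurable_scaleR borel_measurable_indicator)
        (auto intro!: borel_measurable_continuous_onI continuous_intros)
  qed
  have prod: "indicator ?U y *\<^sub>R exp (\<i> * complex_of_real (2 * pi * (k \<bullet> y))) = (\<Prod>b\<in>Basis. g b (y \<bullet> b))" for y
  proof -
    have i: "(indicator ?U y :: real) = (\<Prod>b\<in>Basis. indicator {0..<1} (y \<bullet> b))"
    proof (cases "y \<in> ?U")
      case True then show ?thesis by (auto simp: Basis_vec_def inner_axis intro!: prod.neutral)
    next
      case False
      then obtain j where j: "\<not> (0 \<le> y $ j \<and> y $ j < 1)" by auto
      have "axis j 1 \<in> (Basis :: (real ^ 'n) set)" "indicator {0..<1} (y \<bullet> axis j 1) = (0 :: real)"
        using j by (auto simp: Basis_vec_def inner_axis)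
      then have "(\<Prod>b\<in>Basis. indicator {0..<1} (y \<bullet> b)) = (0 :: real)"
        by (intro prod_zero) auto
      then show ?thesis using False by simp
    qed
    have "\<i> * complex_of_real (2 * pi * (k \<bullet> y)) = (\<Sum>b\<in>Basis. \<i> * complex_of_real (2 * pi * (k \<bullet> b) * (y \<bullet> b)))"
      by (subst euclidean_inner) (simp add: sum_distrib_left mult.assoc)
    then have e: "exp (\<i> * complex_of_real (2 * pi * (k \<bullet> y))) = (\<Prod>b\<in>Basis. exp (\<i> * complex_of_real (2 * pi * (k \<bullet> b) * (y \<bullet> b))))"
      by (simp add: exp_sum)
    show ?thesis unfolding i e g_def by (simp add: scaleR_conv_of_real prod.distrib)
  qed
  obtain j where j: "k $ j \<noteq> 0" using k(2) by (auto simp: vec_eq_iff)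
  have "(LINT t|lborel. g (axis j 1) t) = 0"
  proof -
    define a where "a = 2 * pi * (k $ j)"
    have a: "a \<noteq> 0" using j by (simp add: a_def)
    have "k $ j \<in> \<int>" using k(1) by (simp add: integer_vectors_def)
    then obtain m where m: "k $ j = of_int m" by (auto elim: Ints_cases)
    have per: "exp (\<i> * complex_of_real a) = 1"
      using exp_eq_1[of "\<i> * complex_of_real a"] by (auto simp: a_def m)
    \<comment> \<open>Passing to the closed interval changes a single point and makes the
      fundamental theorem applicable.\<close>
    have "(LINT t|lborel. g (axis j 1) t) = (LINT t|lborel. indicator {0..1} t *\<^sub>R exp (\<i> * complex_of_real (a * t)))"
    proof (rule integral_cong_AE)
      have "AE t in lborel. t \<noteq> (1 :: real)" by (rule AE_lborel_singleton)
      then show "AE t in lborel. g (axis j 1) t = indicator {0..1} t *\<^sub>R exp (\<i> * complex_of_real (a * t))"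
        by eventually_elim (auto simp: g_def a_def inner_axis split: split_indicator)
    qed (simp_all add: g_def)
    also have "\<dots> = exp (\<i> * complex_of_real (a * 1)) / (\<i> * a) - exp (\<i> * complex_of_real (a * 0)) / (\<i> * a)"
    proof (rule integral_FTC_Icc)
      fix t :: real
      have "((\<lambda>z. exp (\<i> * complex_of_real a * z) / (\<i> * a)) has_field_derivative exp (\<i> * complex_of_real (a * t))) (at (of_real t))"
        using a by (auto intro!: derivative_eq_intros simp: mult.assoc)
      then have "((\<lambda>t. exp (\<i> * complex_of_real a * of_real t) / (\<i> * a)) has_vector_derivative exp (\<i> * complex_of_real (a * t))) (at t within {0..1})"
        by (rule has_vector_derivative_real_field)
      then show "((\<lambda>t. exp (\<i> * complex_of_real (a * t)) / (\<i> * a)) has_vector_derivative exp (\<i> * complex_of_real (a * t))) (at t within {0..1})"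
        by (simp add: mult.assoc)
    qed (auto intro!: continuous_intros)
    also have "\<dots> = 0" using per by simp
    finally show ?thesis .
  qed
  then have "(\<Prod>b\<in>Basis. LINT t|lborel. g b t) = 0"
    by (intro prod_zero) (auto simp: Basis_vec_def intro!: bexI[of _ "axis j 1"])
  then have zero: "(LINT y|torus_measure. exp (\<i> * complex_of_real (2 * pi * (k \<bullet> y)))) = 0"
    unfolding integral_torus_measure prod using lborel_integral_prod_inner[OF gi, of "\<lambda>b. b"] by simp
  interpret T: finite_measure "torus_measure :: (real ^ 'n) measure" by (rule finite_measure_torus_measure)
  have int: "integrable (torus_measure :: (real ^ 'n) measure) (\<lambda>y. exp (\<i> * complex_of_real (2 * pi * (k \<bullet> y))))"
    by (rule T.integrable_const_bound[where B = 1]) (auto intro!: measurable_torus_measure borel_measurable_continuous_onI continuous_intros)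
  have "(LINT y|torus_measure. cos (2 * pi * (k \<bullet> y) + c))
      = (LINT y|torus_measure. Re (exp (\<i> * complex_of_real c) * exp (\<i> * complex_of_real (2 * pi * (k \<bullet> y)))))"
    by (intro Bochner_Integration.integral_cong) (simp_all add: exp_add[symmetric] Re_exp add.commute)
  also have "\<dots> = Re (LINT y|torus_measure. exp (\<i> * complex_of_real c) * exp (\<i> * complex_of_real (2 * pi * (k \<bullet> y))))"
    by (rule integral_Re) (use int in auto)
  also have "\<dots> = 0" using zero by simp
  finally show ?thesis .
qed

section \<open>Averaging of oscillating integrands\<close>

text \<open>What the averaging argument asks of the surface measure. \<open>level_null\<close> says
  that the image of \<open>M\<close> under \<open>k \<bullet> x\<close> is absolutely continuous for
  each nonzero integral \<open>k\<close>; the normal and IDDC enter through this alone.\<close>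

locale nonresonant_measure = finite_measure M for M :: "(real ^ 'n) measure" +
  assumes borel_measurable: "\<And>f :: real ^ 'n \<Rightarrow> real. f \<in> borel_measurable borel \<Longrightarrow> f \<in> borel_measurable M"
    and level_null: "\<And>k N. k \<in> integer_vectors \<Longrightarrow> k \<noteq> 0 \<Longrightarrow> N \<in> null_sets lborel \<Longrightarrow> {x \<in> space M. k \<bullet> x \<in> N} \<in> null_sets M"
begin

text \<open>The limit alone would not be stable under addition, because the Bochner integral of a
  nonintegrable function is 0 by convention; the integrability clauses are carried along for this
  reason.\<close>

definition averages :: "(real ^ 'n \<Rightarrow> real ^ 'n \<Rightarrow> real) \<Rightarrow> bool" where
  "averages a \<longleftrightarrow> (\<forall>\<epsilon>. \<epsilon> \<noteq> 0 \<longrightarrow> integrable M (\<lambda>x. a x (x /\<^sub>R \<epsilon>))) \<and>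
     (\<forall>x\<in>space M. integrable torus_measure (a x)) \<and>
     integrable M (\<lambda>x. LINT y|torus_measure. a x y) \<and>
     ((\<lambda>\<epsilon>. LINT x|M. a x (x /\<^sub>R \<epsilon>)) \<longlongrightarrow> (LINT x|M. LINT y|torus_measure. a x y)) (at 0)"

lemma averages_zero: "averages (\<lambda>x y. 0)"
  by (simp add: averages_def)

lemma averages_add:
  assumes "averages a" "averages b"
  shows "averages (\<lambda>x y. a x y + b x y)"
proof -
  have eq: "(LINT x|M. a x (x /\<^sub>R \<epsilon>) + b x (x /\<^sub>R \<epsilon>)) = (LINT x|M. a x (x /\<^sub>R \<epsilon>)) + (LINT x|M. b x (x /\<^sub>R \<epsilon>))"
    if "\<epsilon> \<noteq> 0" for \<epsilon>
    using assms that by (intro Bochner_Integration.integral_add) (auto simp: averages_def)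
  have inner: "(LINT y|torus_measure. a x y + b x y) = (LINT y|torus_measure. a x y) + (LINT y|torus_measure. b x y)"
    if "x \<in> space M" for x
    using assms that by (intro Bochner_Integration.integral_add) (auto simp: averages_def)
  have outer: "(LINT x|M. LINT y|torus_measure. a x y + b x y) =
      (LINT x|M. LINT y|torus_measure. a x y) + (LINT x|M. LINT y|torus_measure. b x y)"
  proof -
    have "(LINT x|M. LINT y|torus_measure. a x y + b x y) =
        (LINT x|M. (LINT y|torus_measure. a x y) + (LINT y|torus_measure. b x y))"
      by (intro Bochner_Integration.integral_cong inner) auto
    also have "\<dots> = (LINT x|M. LINT y|torus_measure. a x y) + (LINT x|M. LINT y|torus_measure. b x y)"
      using assms by (intro Bochner_Integration.integral_add) (auto simp: averages_def)
    finally show ?thesis .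
  qed
  have "((\<lambda>\<epsilon>. (LINT x|M. a x (x /\<^sub>R \<epsilon>)) + (LINT x|M. b x (x /\<^sub>R \<epsilon>))) \<longlongrightarrow>
      (LINT x|M. LINT y|torus_measure. a x y) + (LINT x|M. LINT y|torus_measure. b x y)) (at 0)"
    using assms by (intro tendsto_add) (auto simp: averages_def)
  then have "((\<lambda>\<epsilon>. LINT x|M. a x (x /\<^sub>R \<epsilon>) + b x (x /\<^sub>R \<epsilon>)) \<longlongrightarrow> (LINT x|M. LINT y|torus_measure. a x y + b x y)) (at 0)"
    unfolding outer
    by (rule Lim_transform_eventually) (auto simp: eq eventually_at intro: exI[of _ 1])
  moreover have "integrable M (\<lambda>x. LINT y|torus_measure. a x y + b x y)"
    using assms by (subst Bochner_Integration.integrable_cong[OF refl inner]) (auto simp: averages_def)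
  ultimately show ?thesis using assms by (auto simp: averages_def)
qed

lemma averages_sum:
  "finite I \<Longrightarrow> (\<And>i. i \<in> I \<Longrightarrow> averages (a i)) \<Longrightarrow> averages (\<lambda>x y. \<Sum>i\<in>I. a i x y)"
  by (induction I rule: finite_induct) (auto intro: averages_zero averages_add)

text \<open>The bound holds for every \<open>y\<close>, in particular for
  \<open>y = x /\<^sub>R \<epsilon>\<close>, so the oscillating and the averaged integral each
  change by at most \<open>e\<close> times the integral of \<open>w\<close>, uniformly in
  \<epsilon>. The weight \<open>w\<close> admits coefficients that are integrable but
  unbounded.\<close>

lemma averages_limit:
  assumes w: "integrable M w"
    and approx: "\<And>e. 0 < e \<Longrightarrow> \<exists>b. averages b \<and> (\<forall>x\<in>space M. \<forall>y. \<bar>a x y - b x y\<bar> \<le> e * w x)"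
  shows "averages a"
proof -
  interpret T: finite_measure "torus_measure :: (real ^ 'n) measure" by (rule finite_measure_torus_measure)
  have w0: "0 \<le> w x" if x: "x \<in> space M" for x
  proof -
    obtain b where "\<bar>a x 0 - b x 0\<bar> \<le> 1 * w x" using approx[of 1] x by fastforce
    then show ?thesis by simp
  qed
  have "\<forall>n. \<exists>b. averages b \<and> (\<forall>x\<in>space M. \<forall>y. \<bar>a x y - b x y\<bar> \<le> inverse (real (Suc n)) * w x)"
    using approx by simp
  \<comment> \<open>The sequence supplies measurability and integrability of the limit; the
    convergence in \<epsilon> uses a single approximant \<open>c\<close>.\<close>
  then obtain b where b: "\<And>n. averages (b n)"
      "\<And>n x y. x \<in> space M \<Longrightarrow> \<bar>a x y - b n x y\<bar> \<le> inverse (real (Suc n)) * w x" by metis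
  have lim: "(\<lambda>n. b n x y) \<longlonglongrightarrow> a x y" if "x \<in> space M" for x y
  proof -
    have "(\<lambda>n. a x y - b n x y) \<longlonglongrightarrow> 0"
    proof (rule Lim_null_comparison)
      show "\<forall>\<^sub>F n in sequentially. norm (a x y - b n x y) \<le> inverse (real (Suc n)) * w x"
        using b(2)[OF that] by simp
      show "(\<lambda>n. inverse (real (Suc n)) * w x) \<longlonglongrightarrow> 0"
        by (rule tendsto_mult_left_zero[OF LIMSEQ_inverse_real_of_nat])
    qed
    from tendsto_diff[OF tendsto_const[of "a x y"] this] show ?thesis by simp
  qed
  have b0: "\<bar>a x y\<bar> \<le> \<bar>b 0 x y\<bar> + w x" if "x \<in> space M" for x y
    using b(2)[OF that, of y 0] by simp
  have int: "integrable M (\<lambda>x. a x (x /\<^sub>R \<epsilon>))" if \<epsilon>: "\<epsilon> \<noteq> 0" for \<epsilon>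
  proof (rule Bochner_Integration.integrable_bound)
    show "integrable M (\<lambda>x. \<bar>b 0 x (x /\<^sub>R \<epsilon>)\<bar> + w x)"
      using b(1)[of 0] \<epsilon> w by (intro Bochner_Integration.integrable_add integrable_abs) (auto simp: averages_def)
    show "(\<lambda>x. a x (x /\<^sub>R \<epsilon>)) \<in> borel_measurable M"
    proof (rule borel_measurable_LIMSEQ_real)
      show "(\<lambda>n. b n x (x /\<^sub>R \<epsilon>)) \<longlonglongrightarrow> a x (x /\<^sub>R \<epsilon>)" if "x \<in> space M" for x by (rule lim[OF that])
      show "(\<lambda>x. b n x (x /\<^sub>R \<epsilon>)) \<in> borel_measurable M" for n
        using b(1)[of n] \<epsilon> by (auto simp: averages_def)
    qed
    show "AE x in M. norm (a x (x /\<^sub>R \<epsilon>)) \<le> norm (\<bar>b 0 x (x /\<^sub>R \<epsilon>)\<bar> + w x)"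
      by (rule AE_I2) (use b0 w0 in auto)
  qed
  have inner: "integrable torus_measure (a x)" if x: "x \<in> space M" for x
  proof (rule Bochner_Integration.integrable_bound)
    show "integrable torus_measure (\<lambda>y. \<bar>b 0 x y\<bar> + w x)"
      using b(1)[of 0] x by (intro Bochner_Integration.integrable_add integrable_abs) (auto simp: averages_def)
    show "a x \<in> borel_measurable torus_measure"
    proof (rule borel_measurable_LIMSEQ_real)
      show "(\<lambda>n. b n x y) \<longlonglongrightarrow> a x y" for y by (rule lim[OF x])
      show "b n x \<in> borel_measurable torus_measure" for n
        using b(1)[of n] x by (auto simp: averages_def)
    qed
    show "AE y in torus_measure. norm (a x y) \<le> norm (\<bar>b 0 x y\<bar> + w x)"
      by (rule AE_I2) (use b0[OF x] w0[OF x] in auto)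
  qed
  have inner_diff: "\<bar>(LINT y|torus_measure. a x y) - (LINT y|torus_measure. c x y)\<bar> \<le> e * w x"
    if x: "x \<in> space M" and c: "averages c" "\<And>y. \<bar>a x y - c x y\<bar> \<le> e * w x" for x e c
  proof -
    have ci: "integrable torus_measure (c x)" using c(1) x by (auto simp: averages_def)
    have "\<bar>(LINT y|torus_measure. a x y) - (LINT y|torus_measure. c x y)\<bar> = \<bar>LINT y|torus_measure. a x y - c x y\<bar>"
      using inner[OF x] ci by simp
    also have "\<dots> \<le> (LINT y|torus_measure. \<bar>a x y - c x y\<bar>)" by (rule integral_abs_bound)
    also have "\<dots> \<le> (LINT y|(torus_measure :: (real ^ 'n) measure). e * w x)"
      by (intro integral_mono) (use inner[OF x] ci c(2) in auto)
    also have "\<dots> = e * w x" by simp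
    finally show ?thesis .
  qed
  have outer: "integrable M (\<lambda>x. LINT y|torus_measure. a x y)"
  proof (rule Bochner_Integration.integrable_bound)
    show "integrable M (\<lambda>x. \<bar>LINT y|torus_measure. b 0 x y\<bar> + w x)"
      using b(1)[of 0] w by (intro Bochner_Integration.integrable_add integrable_abs) (auto simp: averages_def)
    show "(\<lambda>x. LINT y|torus_measure. a x y) \<in> borel_measurable M"
    proof (rule borel_measurable_LIMSEQ_real)
      fix x assume x: "x \<in> space M"
      have "(\<lambda>n. (LINT y|torus_measure. a x y) - (LINT y|torus_measure. b n x y)) \<longlonglongrightarrow> 0"
      proof (rule Lim_null_comparison)
        show "\<forall>\<^sub>F n in sequentially. norm ((LINT y|torus_measure. a x y) - (LINT y|torus_measure. b n x y)) \<le> inverse (real (Suc n)) * w x"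
          using inner_diff[OF x b(1) b(2)[OF x]] by simp
        show "(\<lambda>n. inverse (real (Suc n)) * w x) \<longlonglongrightarrow> 0"
          by (rule tendsto_mult_left_zero[OF LIMSEQ_inverse_real_of_nat])
      qed
      from tendsto_diff[OF tendsto_const[of "LINT y|torus_measure. a x y"] this]
      show "(\<lambda>n. LINT y|torus_measure. b n x y) \<longlonglongrightarrow> (LINT y|torus_measure. a x y)" by simp
    next
      show "(\<lambda>x. LINT y|torus_measure. b n x y) \<in> borel_measurable M" for n
        using b(1)[of n] by (auto simp: averages_def)
    qed
    show "AE x in M. norm (LINT y|torus_measure. a x y) \<le> norm (\<bar>LINT y|torus_measure. b 0 x y\<bar> + w x)"
    proof (rule AE_I2)
      fix x assume x: "x \<in> space M"
      show "norm (LINT y|torus_measure. a x y) \<le> norm (\<bar>LINT y|torus_measure. b 0 x y\<bar> + w x)"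
        using inner_diff[OF x b(1)[of 0], of 1] b(2)[OF x, of _ 0] w0[OF x] by simp
    qed
  qed
  have "((\<lambda>\<epsilon>. LINT x|M. a x (x /\<^sub>R \<epsilon>)) \<longlongrightarrow> (LINT x|M. LINT y|torus_measure. a x y)) (at 0)"
  proof (rule tendstoI)
    fix e :: real assume e: "0 < e"
    define W where "W = (LINT x|M. w x)"
    have W: "0 \<le> W" unfolding W_def by (rule integral_nonneg_AE) (use w0 in auto)
    \<comment> \<open>Each of three errors stays below \<open>e / 3\<close>; \<open>W + 1\<close>
      covers the case \<open>W = 0\<close>.\<close>
    define d where "d = e / (3 * (W + 1))"
    have d: "0 < d" "d * W < e / 3" using e W by (auto simp: d_def field_simps)
    obtain c where c: "averages c" "\<And>x y. x \<in> space M \<Longrightarrow> \<bar>a x y - c x y\<bar> \<le> d * w x"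
      using approx[OF d(1)] by blast
    have bound: "\<bar>(LINT x|M. u x) - (LINT x|M. v x)\<bar> < e / 3"
      if "integrable M u" "integrable M v" "\<And>x. x \<in> space M \<Longrightarrow> \<bar>u x - v x\<bar> \<le> d * w x" for u v
    proof -
      have "\<bar>(LINT x|M. u x) - (LINT x|M. v x)\<bar> = \<bar>LINT x|M. u x - v x\<bar>" using that by simp
      also have "\<dots> \<le> (LINT x|M. \<bar>u x - v x\<bar>)" by (rule integral_abs_bound)
      also have "\<dots> \<le> (LINT x|M. d * w x)"
        by (intro integral_mono) (use that w in auto)
      also have "\<dots> = d * W" by (simp add: W_def)
      finally show ?thesis using d by simp
    qed
    have 1: "\<bar>(LINT x|M. LINT y|torus_measure. a x y) - (LINT x|M. LINT y|torus_measure. c x y)\<bar> < e / 3"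
      using c(1) by (intro bound outer inner_diff c) (auto simp: averages_def)
    have 2: "\<bar>(LINT x|M. a x (x /\<^sub>R \<epsilon>)) - (LINT x|M. c x (x /\<^sub>R \<epsilon>))\<bar> < e / 3" if "\<epsilon> \<noteq> 0" for \<epsilon>
      using c(1) that by (intro bound int c) (auto simp: averages_def)
    have "\<forall>\<^sub>F \<epsilon> in at 0. dist (LINT x|M. c x (x /\<^sub>R \<epsilon>)) (LINT x|M. LINT y|torus_measure. c x y) < e / 3"
      using c(1) e unfolding averages_def by (intro tendstoD) auto
    moreover have "\<forall>\<^sub>F \<epsilon> in at 0. \<epsilon> \<noteq> (0 :: real)" by (auto simp: eventually_at intro: exI[of _ 1])
    ultimately show "\<forall>\<^sub>F \<epsilon> in at 0. dist (LINT x|M. a x (x /\<^sub>R \<epsilon>)) (LINT x|M. LINT y|torus_measure. a x y) < e"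
    proof eventually_elim
      case (elim \<epsilon>)
      then show ?case using 1 2[of \<epsilon>] unfolding dist_real_def by linarith
    qed
  qed
  then show ?thesis using int inner outer by (simp add: averages_def)
qed

lemma averages_character:
  assumes h: "integrable M h" and k: "k \<in> integer_vectors"
  shows "averages (\<lambda>x y. h x * cos (2 * pi * (k \<bullet> y) + c))"
proof (cases "k = 0")
  \<comment> \<open>Without oscillation the integrand is independent of \<open>y\<close>, and both
    sides agree because the torus has mass 1.\<close>
  case True
  interpret T: finite_measure "torus_measure :: (real ^ 'n) measure" by (rule finite_measure_torus_measure)
  show ?thesis using True h by (simp add: averages_def)
next
  case False
  interpret T: finite_measure "torus_measure :: (real ^ 'n) measure" by (rule finite_measure_torus_measure)
  have meas: "(\<lambda>x. k \<bullet> x) \<in> borel_measurable M" by (rule borel_measurable) simp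
  have int: "integrable M (\<lambda>x. h x * cos (2 * pi * (k \<bullet> (x /\<^sub>R \<epsilon>)) + c))" for \<epsilon>
    using meas by (intro integrable_mult_cos h) simp
  have inner: "integrable torus_measure (\<lambda>y. h x * cos (2 * pi * (k \<bullet> y) + c))" for x
    by (intro integrable_mult_right T.integrable_const_bound[where B = 1])
       (auto intro!: measurable_torus_measure borel_measurable_continuous_onI continuous_intros)
  have "((\<lambda>s. LINT x|M. h x * cos (s * (k \<bullet> x) + c)) \<longlongrightarrow> 0) at_infinity"
  proof (rule Riemann_Lebesgue_pushforward[OF finite_measure_axioms meas _ h])
    fix N :: "real set" assume N: "N \<in> null_sets lborel"
    have "(\<lambda>x. k \<bullet> x) -` N \<inter> space M = {x \<in> space M. k \<bullet> x \<in> N}" by auto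
    then show "(\<lambda>x. k \<bullet> x) -` N \<inter> space M \<in> null_sets M" using level_null[OF k False N] by simp
  qed
  \<comment> \<open>The filter \<open>at 0\<close> is two-sided, so the frequency tends to
    \<open>at_infinity\<close> and not to \<open>at_top\<close>.\<close>
  moreover have "filterlim (\<lambda>\<epsilon>. 2 * pi * inverse \<epsilon>) at_infinity (at (0::real))"
    by (rule tendsto_mult_filterlim_at_infinity[OF tendsto_const]) (auto intro: filterlim_inverse_at_infinity)
  ultimately have "((\<lambda>\<epsilon>. LINT x|M. h x * cos (2 * pi * inverse \<epsilon> * (k \<bullet> x) + c)) \<longlongrightarrow> 0) (at 0)"
    by (rule filterlim_compose)
  then have lim: "((\<lambda>\<epsilon>. LINT x|M. h x * cos (2 * pi * (k \<bullet> (x /\<^sub>R \<epsilon>)) + c)) \<longlongrightarrow> 0) (at 0)"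
    by (simp add: mult.assoc)
  have zero: "(LINT y|torus_measure. h x * cos (2 * pi * (k \<bullet> y) + c)) = 0" for x
    using integral_torus_character[OF k False, of c] by simp
  show ?thesis
    unfolding averages_def zero by (intro conjI allI impI ballI int inner) (use lim in simp_all)
qed

end

section \<open>Trigonometric polynomials\<close>

text \<open>Amplitude and phase keep the polynomials real-valued; the phase \<open>- pi / 2\<close>
  produces the sines.\<close>

inductive trig_poly :: "(real ^ 'n \<Rightarrow> real) \<Rightarrow> bool" where
  character: "k \<in> integer_vectors \<Longrightarrow> trig_poly (\<lambda>y. a * cos (2 * pi * (k \<bullet> y) + c))"
| add: "trig_poly f \<Longrightarrow> trig_poly g \<Longrightarrow> trig_poly (\<lambda>y. f y + g y)"

lemma integer_vectors_closed:
  "0 \<in> integer_vectors" "k \<in> integer_vectors \<Longrightarrow> l \<in> integer_vectors \<Longrightarrow> k + l \<in> integer_vectors"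
  "k \<in> integer_vectors \<Longrightarrow> l \<in> integer_vectors \<Longrightarrow> k - l \<in> integer_vectors"
  "axis i 1 \<in> integer_vectors" "(\<chi> i. of_int (m i)) \<in> integer_vectors"
  by (auto simp: integer_vectors_def axis_def)

lemma trig_poly_const: "trig_poly (\<lambda>y. a)"
  using trig_poly.character[OF integer_vectors_closed(1), of a 0] by simp

text \<open>The product-to-sum formula turns the frequencies \<open>k\<close> and \<open>l\<close>
  into \<open>k - l\<close> and \<open>k + l\<close>, which are again integral.\<close>

lemma trig_poly_character_mult:
  assumes "trig_poly g" and k: "k \<in> integer_vectors"
  shows "trig_poly (\<lambda>y. a * cos (2 * pi * (k \<bullet> y) + c) * g y)"
  using assms(1)
proof induction
  case (character l b d)
  have "trig_poly (\<lambda>y. a * b / 2 * cos (2 * pi * ((k - l) \<bullet> y) + (c - d)) + a * b / 2 * cos (2 * pi * ((k + l) \<bullet> y) + (c + d)))"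
    by (intro trig_poly.intros integer_vectors_closed k character)
  moreover have "a * b / 2 * cos (2 * pi * ((k - l) \<bullet> y) + (c - d)) + a * b / 2 * cos (2 * pi * ((k + l) \<bullet> y) + (c + d))
      = a * cos (2 * pi * (k \<bullet> y) + c) * (b * cos (2 * pi * (l \<bullet> y) + d))" for y
  proof -
    have "2 * pi * ((k - l) \<bullet> y) + (c - d) = (2 * pi * (k \<bullet> y) + c) - (2 * pi * (l \<bullet> y) + d)"
      "2 * pi * ((k + l) \<bullet> y) + (c + d) = (2 * pi * (k \<bullet> y) + c) + (2 * pi * (l \<bullet> y) + d)"
      by (simp_all add: inner_diff_left inner_add_left algebra_simps)
    then show ?thesis by (simp only: cos_add cos_diff) (simp add: algebra_simps)
  qed
  ultimately show ?case by simp
next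
  case (add g h)
  from trig_poly.add[OF add.IH] show ?case by (simp add: distrib_left)
qed

lemma trig_poly_mult: "trig_poly f \<Longrightarrow> trig_poly g \<Longrightarrow> trig_poly (\<lambda>y. f y * g y)"
proof (induction rule: trig_poly.induct)
  case (character k a c)
  then show ?case by (intro trig_poly_character_mult)
next
  case (add f h)
  from trig_poly.add[OF add.IH[OF add.prems]] show ?case by (simp add: distrib_right)
qed

section \<open>The torus as a compact set\<close>

text \<open>The quotient of \<open>real ^ 'n\<close> by the integer vectors, realised as a compact
  product of circles, so that Stone-Weierstrass and finite subcovers become applicable to functions
  on the torus.\<close>

definition torus_embedding :: "real ^ 'n \<Rightarrow> complex ^ 'n" where
  "torus_embedding y = (\<chi> i. cis (2 * pi * y $ i))"

lemma continuous_on_torus_embedding: "continuous_on A torus_embedding"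
  unfolding torus_embedding_def by (intro continuous_intros)

lemma ex_integer_translate:
  fixes y :: "real ^ 'n"
  obtains k where "k \<in> integer_vectors" "\<And>i. 0 \<le> (y - k) $ i" "\<And>i. (y - k) $ i < 1"
proof
  show "(\<chi> i. of_int \<lfloor>y $ i\<rfloor>) \<in> integer_vectors" by (rule integer_vectors_closed)
  show "0 \<le> (y - (\<chi> i. of_int \<lfloor>y $ i\<rfloor>)) $ i" "(y - (\<chi> i. of_int \<lfloor>y $ i\<rfloor>)) $ i < 1" for i
    by (simp_all add: of_int_floor_le) linarith
qed

lemma cis_2pi_diff_int: "m \<in> \<int> \<Longrightarrow> cis (2 * pi * (t - m)) = cis (2 * pi * t)"
  by (elim Ints_cases) (simp add: cis.ctr right_diff_distrib cos_diff sin_diff)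

lemma torus_embedding_in_image: "torus_embedding y \<in> torus_embedding ` cbox 0 1"
proof -
  obtain k where k: "k \<in> integer_vectors" "\<And>i. 0 \<le> (y - k) $ i" "\<And>i. (y - k) $ i < 1"
    using ex_integer_translate[of y] by blast
  have "torus_embedding (y - k) = torus_embedding y"
    using k(1) by (simp add: torus_embedding_def vec_eq_iff integer_vectors_def cis_2pi_diff_int)
  moreover have "y - k \<in> cbox 0 1" using k(2,3) by (simp add: mem_box_cart less_imp_le)
  ultimately show ?thesis by (metis image_eqI)
qed

lemma compact_torus: "compact (torus_embedding ` cbox 0 1)"
  by (intro compact_continuous_image continuous_on_torus_embedding compact_cbox)

text \<open>Stone-Weierstrass on the embedded torus: the trigonometric polynomials form an algebra
  there, and the real and imaginary parts of the coordinates, which are cosines and sines of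
  frequency \<open>axis i 1\<close>, separate points.\<close>

lemma trig_poly_dense:
  fixes F :: "complex ^ 'n \<Rightarrow> real"
  assumes F: "continuous_on (torus_embedding ` cbox 0 1) F" and e: "0 < e"
  shows "\<exists>T. trig_poly T \<and> (\<forall>y. \<bar>F (torus_embedding y) - T y\<bar> < e)"
proof -
  let ?S = "torus_embedding ` cbox (0 :: real ^ 'n) 1"
  define P where "P G \<longleftrightarrow> continuous_on ?S G \<and> (\<exists>T. trig_poly T \<and> (\<forall>y. G (torus_embedding y) = T y))" for G
  have "\<exists>G. P G \<and> (\<forall>x\<in>?S. \<bar>F x - G x\<bar> < e)"
  proof (rule Stone_Weierstrass_HOL[where P = P, OF compact_torus])
    show "P (\<lambda>x. c)" for c unfolding P_def by (intro conjI continuous_on_const exI[of _ "\<lambda>y. c"] trig_poly_const) simp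
    show "continuous_on ?S f" if "P f" for f using that by (simp add: P_def)
    show "P (\<lambda>x. f x + g x)" if "P f \<and> P g" for f g
      using that unfolding P_def by (auto intro!: continuous_intros trig_poly.add)
    show "P (\<lambda>x. f x * g x)" if "P f \<and> P g" for f g
      using that unfolding P_def by (auto intro!: continuous_intros trig_poly_mult)
    show "\<exists>f. P f \<and> f x \<noteq> f y" if "x \<in> ?S \<and> y \<in> ?S \<and> x \<noteq> y" for x y
    proof -
      obtain i where i: "x $ i \<noteq> y $ i" using \<open>x \<in> ?S \<and> y \<in> ?S \<and> x \<noteq> y\<close> by (auto simp: vec_eq_iff)
      have "trig_poly (\<lambda>y. 1 * cos (2 * pi * (axis i 1 \<bullet> y) + 0))" "trig_poly (\<lambda>y. 1 * cos (2 * pi * (axis i 1 \<bullet> y) + (- pi / 2)))"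
        by (intro trig_poly.character integer_vectors_closed)+
      moreover have "cos (t + (- pi / 2)) = sin t" for t using cos_diff[of t "pi / 2"] by simp
      ultimately have "trig_poly (\<lambda>y. cos (2 * pi * y $ i))" "trig_poly (\<lambda>y. sin (2 * pi * y $ i))"
        by (simp_all only: inner_axis' inner_real_def mult_1 add_0_right)
      then have "P (\<lambda>w. Re (w $ i))" "P (\<lambda>w. Im (w $ i))"
        unfolding P_def by (auto simp: torus_embedding_def intro!: continuous_intros)
      then show ?thesis using i complex_eq_iff by metis
    qed
  qed (use F e in auto)
  then obtain G where "P G" "\<And>x. x \<in> ?S \<Longrightarrow> \<bar>F x - G x\<bar> < e" by blast
  then show ?thesis unfolding P_def using torus_embedding_in_image by metis
qed

text \<open>Modulo the integers, the points at distance at least \<delta> from 0 form a compact set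
  on which \<open>cis (2 * pi * t)\<close> stays away from 1. Subtracting \<open>round t\<close>
  selects the representative in \<open>{-(1/2)..1/2}\<close>.\<close>

lemma close_to_integer:
  fixes \<delta> :: real
  assumes "0 < \<delta>"
  shows "\<exists>r>0. \<forall>t. norm (cis (2 * pi * t) - 1) < r \<longrightarrow> (\<exists>m::int. \<bar>t - of_int m\<bar> < \<delta>)"
proof -
  define K where "K = {-(1/2)..1/2::real} \<inter> - {-\<delta><..<\<delta>}"
  have "compact K" unfolding K_def by (intro compact_Int_closed closed_Compl) auto
  have "\<exists>r>0. \<forall>t\<in>K. r \<le> norm (cis (2 * pi * t) - 1)"
  proof (cases "K = {}")
    case True then show ?thesis by (intro exI[of _ 1]) auto
  next
    case False
    have "continuous_on K (\<lambda>t. norm (cis (2 * pi * t) - 1))" by (intro continuous_intros)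
    then obtain t0 where t0: "t0 \<in> K" "\<And>t. t \<in> K \<Longrightarrow> norm (cis (2 * pi * t0) - 1) \<le> norm (cis (2 * pi * t) - 1)"
      using continuous_attains_inf[OF \<open>compact K\<close> False] by blast
    have "cis (2 * pi * t0) \<noteq> 1"
    proof
      assume "cis (2 * pi * t0) = 1"
      then have "cos (2 * pi * t0) = 1" by (simp add: complex_eq_iff)
      then obtain m :: int where "2 * pi * t0 = of_int m * 2 * pi" by (auto simp: cos_one_2pi_int)
      then have "t0 = of_int m" by simp
      moreover have "\<bar>t0\<bar> \<le> 1 / 2" using t0(1) by (auto simp: K_def)
      ultimately have "\<bar>m\<bar> < 1" by linarith
      then have "t0 = 0" using \<open>t0 = of_int m\<close> by simp
      then show False using t0(1) assms by (simp add: K_def)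
    qed
    then show ?thesis using t0(2) by (intro exI[of _ "norm (cis (2 * pi * t0) - 1)"]) auto
  qed
  then obtain r where r: "r > 0" "\<And>t. t \<in> K \<Longrightarrow> r \<le> norm (cis (2 * pi * t) - 1)" by blast
  show ?thesis
  proof (rule exI[of _ r], intro conjI allI impI)
    fix t :: real assume t: "norm (cis (2 * pi * t) - 1) < r"
    define u where "u = t - of_int (round t)"
    have "\<bar>u\<bar> \<le> 1 / 2" using of_int_round_abs_le[of t] by (simp add: u_def abs_minus_commute)
    moreover have "cis (2 * pi * u) = cis (2 * pi * t)" unfolding u_def by (rule cis_2pi_diff_int) simp
    then have "u \<notin> K" using t r(2)[of u] by auto
    ultimately have "\<bar>u\<bar> < \<delta>" by (auto simp: K_def)
    then show "\<exists>m::int. \<bar>t - of_int m\<bar> < \<delta>" unfolding u_def by blast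
  qed (rule r)
qed

lemma close_in_torus:
  fixes \<delta> :: real
  assumes "0 < \<delta>"
  shows "\<exists>r>0. \<forall>y p :: real ^ 'n. dist (torus_embedding y) (torus_embedding p) < r \<longrightarrow> (\<exists>k\<in>integer_vectors. dist (y - k) p < \<delta>)"
proof -
  \<comment> \<open>The norm is bounded by the sum over \<open>CARD('n)\<close> coordinates, each of
    which is kept below \<open>d\<close>.\<close>
  define d where "d = \<delta> / CARD('n)"
  have d: "0 < d" using assms by (simp add: d_def)
  obtain r where r: "r > 0" "\<And>t. norm (cis (2 * pi * t) - 1) < r \<Longrightarrow> \<exists>m::int. \<bar>t - of_int m\<bar> < d"
    using close_to_integer[OF d] by blast
  show ?thesis
  proof (rule exI[of _ r], intro conjI allI impI)
    fix y p :: "real ^ 'n" assume yp: "dist (torus_embedding y) (torus_embedding p) < r"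
    have "\<exists>m::int. \<bar>(y $ i - p $ i) - of_int m\<bar> < d" for i
    proof (rule r(2))
      have "cis (2 * pi * (y $ i - p $ i)) - 1 = (cis (2 * pi * y $ i) - cis (2 * pi * p $ i)) / cis (2 * pi * p $ i)"
        by (simp add: diff_divide_distrib cis_divide right_diff_distrib)
      then have "norm (cis (2 * pi * (y $ i - p $ i)) - 1) = norm ((torus_embedding y - torus_embedding p) $ i)"
        by (simp add: norm_divide torus_embedding_def)
      also have "\<dots> \<le> norm (torus_embedding y - torus_embedding p)" by (rule Finite_Cartesian_Product.norm_nth_le)
      finally show "norm (cis (2 * pi * (y $ i - p $ i)) - 1) < r" using yp by (simp add: dist_norm)
    qed
    then obtain m :: "'n \<Rightarrow> int" where m: "\<And>i. \<bar>(y $ i - p $ i) - of_int (m i)\<bar> < d" by metis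
    define k :: "real ^ 'n" where "k = (\<chi> i. of_int (m i))"
    have "norm (y - k - p) \<le> (\<Sum>i\<in>UNIV. \<bar>(y - k - p) $ i\<bar>)" by (rule norm_le_l1_cart)
    also have "\<dots> < (\<Sum>i\<in>(UNIV::'n set). d)"
    proof (rule sum_strict_mono)
      show "\<bar>(y - k - p) $ i\<bar> < d" for i using m[of i] by (simp add: k_def algebra_simps)
    qed auto
    also have "\<dots> = \<delta>" by (simp add: d_def)
    finally show "\<exists>k\<in>integer_vectors. dist (y - k) p < \<delta>"
      using integer_vectors_closed(5)[of m] by (auto simp: dist_norm k_def)
  qed (rule r)
qed

text \<open>Normalised tents of radius \<open>r\<close> around a finite net of the embedded torus.
  Nearness to \<open>p\<close> holds only up to an integer vector because the tents see
  \<open>y\<close> through \<open>torus_embedding\<close>.\<close>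

lemma torus_partition_of_unity:
  fixes \<delta> :: real
  assumes "0 < \<delta>"
  obtains Y :: "(real ^ 'n) set" and \<psi> where "finite Y"
    "\<And>p. p \<in> Y \<Longrightarrow> continuous_on (torus_embedding ` cbox 0 1) (\<psi> p)"
    "\<And>p w. 0 \<le> \<psi> p w" "\<And>y. (\<Sum>p\<in>Y. \<psi> p (torus_embedding y)) = (1 :: real)"
    "\<And>p y. \<psi> p (torus_embedding y) \<noteq> 0 \<Longrightarrow> \<exists>k\<in>integer_vectors. dist (y - k) p < \<delta>"
proof -
  obtain r where r: "r > 0" "\<And>y p :: real ^ 'n. dist (torus_embedding y) (torus_embedding p) < r \<Longrightarrow> \<exists>k\<in>integer_vectors. dist (y - k) p < \<delta>"
    using close_in_torus[OF assms, where 'n = 'n] by blast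
  let ?S = "torus_embedding ` cbox (0 :: real ^ 'n) 1"
  have "?S \<subseteq> (\<Union>p\<in>cbox 0 1. ball (torus_embedding p) r)" using r(1) by auto
  then obtain Y where Y: "Y \<subseteq> cbox 0 1" "finite Y" "?S \<subseteq> (\<Union>p\<in>Y. ball (torus_embedding p) r)"
    using compactE_image[OF compact_torus, of "cbox 0 1" "\<lambda>p. ball (torus_embedding p) r"] by (metis open_ball)
  define \<rho> where "\<rho> p w = max 0 (r - dist w (torus_embedding p))" for p :: "real ^ 'n" and w
  have pos: "0 < (\<Sum>q\<in>Y. \<rho> q w)" if "w \<in> ?S" for w
  proof -
    obtain p where "p \<in> Y" "dist w (torus_embedding p) < r" using Y(3) \<open>w \<in> ?S\<close> by (auto simp: dist_commute)
    then show ?thesis using Y(2) by (intro sum_pos2[of Y p]) (auto simp: \<rho>_def)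
  qed
  show thesis
  proof (rule that[of Y "\<lambda>p w. \<rho> p w / (\<Sum>q\<in>Y. \<rho> q w)"])
    show "continuous_on ?S (\<lambda>w. \<rho> p w / (\<Sum>q\<in>Y. \<rho> q w))" for p
    proof (rule continuous_on_divide)
      show "\<forall>w\<in>?S. (\<Sum>q\<in>Y. \<rho> q w) \<noteq> 0" using pos less_imp_neq by metis
    qed (auto simp: \<rho>_def intro!: continuous_intros)
    show "0 \<le> \<rho> p w / (\<Sum>q\<in>Y. \<rho> q w)" for p w
      by (intro divide_nonneg_nonneg sum_nonneg) (auto simp: \<rho>_def)
    show "(\<Sum>p\<in>Y. \<rho> p (torus_embedding y) / (\<Sum>q\<in>Y. \<rho> q (torus_embedding y))) = 1" for y
      using pos[OF torus_embedding_in_image, of y] by (simp add: sum_divide_distrib[symmetric])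
    show "\<exists>k\<in>integer_vectors. dist (y - k) p < \<delta>"
      if "\<rho> p (torus_embedding y) / (\<Sum>q\<in>Y. \<rho> q (torus_embedding y)) \<noteq> 0" for p y
      using that by (intro r(2)) (auto simp: \<rho>_def max_def split: if_splits)
  qed (rule Y)
qed

section \<open>Equicontinuous periodic integrands\<close>

text \<open>The radius in \<open>equicontinuous_family\<close> depends on the point. A Lebesgue
  number for the cover of the unit cube by the balls \<open>ball y (d y)\<close> makes it uniform,
  and periodicity moves every point into the cube.\<close>

lemma uniformly_equicontinuous_of_periodic:
  fixes g :: "'i \<Rightarrow> real ^ 'n \<Rightarrow> real"
  assumes eq: "equicontinuous_family I g" and per: "\<And>z. z \<in> I \<Longrightarrow> periodic (g z)" and e: "0 < e"
  shows "\<exists>\<delta>>0. \<forall>z\<in>I. \<forall>y y'. dist y' y < \<delta> \<longrightarrow> \<bar>g z y' - g z y\<bar> < e"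
proof -
  have "\<forall>y. \<exists>\<delta>>0. \<forall>z\<in>I. \<forall>y'. dist y' y < \<delta> \<longrightarrow> dist (g z y') (g z y) < e / 2"
    using eq e unfolding equicontinuous_family_def by (metis half_gt_zero)
  then obtain d where d: "\<And>y. d y > 0" "\<And>y z y'. z \<in> I \<Longrightarrow> dist y' y < d y \<Longrightarrow> dist (g z y') (g z y) < e / 2"
    by metis
  obtain \<delta> where \<delta>: "\<delta> > 0" "\<And>y. y \<in> cbox 0 1 \<Longrightarrow> \<exists>G\<in>range (\<lambda>y. ball y (d y)). ball y \<delta> \<subseteq> G"
  proof (rule Heine_Borel_lemma[of "cbox 0 1" "range (\<lambda>y. ball y (d y))"])
    have "x \<in> ball x (d x)" for x using d(1) by simp
    then show "cbox 0 1 \<subseteq> \<Union>(range (\<lambda>y. ball y (d y)))" by blast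
  qed auto
  show ?thesis
  proof (rule exI[of _ \<delta>], intro conjI ballI allI impI)
    fix z and y y' :: "real ^ 'n" assume z: "z \<in> I" and yy: "dist y' y < \<delta>"
    obtain k where k: "k \<in> integer_vectors" "\<And>i. 0 \<le> (y - k) $ i" "\<And>i. (y - k) $ i < 1"
      using ex_integer_translate[of y] by blast
    have shift: "g z (x - k) = g z x" for x
    proof -
      have "g z ((x - k) + k) = g z (x - k)"
        using per[OF z] k(1) unfolding periodic_def by blast
      then show ?thesis by simp
    qed
    have "y - k \<in> cbox 0 1" using k by (simp add: mem_box_cart less_imp_le)
    \<comment> \<open>Both points are moved by the same \<open>k\<close>; \<open>y' - k\<close> may
      leave the cube but stays in the ball around \<open>y - k\<close>, hence near
      \<open>p\<close>.\<close>
    then obtain p where p: "ball (y - k) \<delta> \<subseteq> ball p (d p)" using \<delta>(2) by blast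
    have "dist (y - k) (y' - k) = dist y' y" by (simp add: dist_norm norm_minus_commute)
    then have "y' - k \<in> ball (y - k) \<delta>" "y - k \<in> ball (y - k) \<delta>" using yy \<delta>(1) by simp_all
    then have "y' - k \<in> ball p (d p)" "y - k \<in> ball p (d p)" using p by blast+
    then have "dist (g z (y' - k)) (g z p) < e / 2" "dist (g z (y - k)) (g z p) < e / 2"
      using d(2)[OF z, of "y' - k" p] d(2)[OF z, of "y - k" p] by (simp_all add: dist_commute)
    then show "\<bar>g z y' - g z y\<bar> < e" unfolding shift dist_real_def by linarith
  qed (rule \<delta>)
qed

context nonresonant_measure
begin

lemma averages_trig_poly:
  assumes h: "integrable M h" and T: "trig_poly T"
  shows "averages (\<lambda>x y. h x * T y)"
  using T
proof induction
  case (character k a c)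
  have "averages (\<lambda>x y. (h x * a) * cos (2 * pi * (k \<bullet> y) + c))"
    using h character by (intro averages_character) auto
  then show ?case by (simp add: mult.assoc)
next
  case (add f g)
  from averages_add[OF add.IH] show ?case by (simp add: distrib_left)
qed

text \<open>The error of a uniform trigonometric approximation of \<open>F\<close> is scaled by
  \<open>h x\<close>, whence the weight \<open>\<bar>h x\<bar>\<close>.\<close>

lemma averages_continuous_factor:
  assumes h: "integrable M h" and F: "continuous_on (torus_embedding ` cbox 0 1) F"
  shows "averages (\<lambda>x y. h x * F (torus_embedding y))"
proof (rule averages_limit[where w = "\<lambda>x. \<bar>h x\<bar>"])
  fix e :: real assume "0 < e"
  then obtain T where T: "trig_poly T" "\<And>y. \<bar>F (torus_embedding y) - T y\<bar> < e"
    using trig_poly_dense[OF F] by blast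
  have "\<bar>h x * F (torus_embedding y) - h x * T y\<bar> \<le> e * \<bar>h x\<bar>" for x y
  proof -
    have "\<bar>h x * F (torus_embedding y) - h x * T y\<bar> = \<bar>h x\<bar> * \<bar>F (torus_embedding y) - T y\<bar>"
      by (simp add: right_diff_distrib[symmetric] abs_mult)
    also have "\<dots> \<le> \<bar>h x\<bar> * e" using T(2)[of y] by (intro mult_left_mono) auto
    finally show ?thesis by (simp add: mult.commute)
  qed
  then show "\<exists>b. averages b \<and> (\<forall>x\<in>space M. \<forall>y. \<bar>h x * F (torus_embedding y) - b x y\<bar> \<le> e * \<bar>h x\<bar>)"
    using averages_trig_poly[OF h T(1)] by (intro exI[of _ "\<lambda>x y. h x * T y"]) blast
qed (use h in auto)

text \<open>Freezing the second argument of \<open>g\<close> at the points \<open>p\<close> of a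
  partition of unity separates the variables. A summand of nonzero weight has \<open>y\<close>
  within \<delta> of \<open>p\<close> up to an integer vector, so periodicity and uniform
  equicontinuity bound the error by \<open>e\<close>, uniformly in \<open>x\<close> and
  \<open>y\<close>.\<close>

theorem averages_equicontinuous:
  assumes int: "\<And>y. integrable M (\<lambda>x. g x y)"
    and eq: "equicontinuous_family (space M) g" and per: "\<And>x. x \<in> space M \<Longrightarrow> periodic (g x)"
  shows "averages g"
proof (rule averages_limit[where w = "\<lambda>x. 1"])
  fix e :: real assume e: "0 < e"
  obtain \<delta> where \<delta>: "\<delta> > 0" "\<And>x y y'. x \<in> space M \<Longrightarrow> dist y' y < \<delta> \<Longrightarrow> \<bar>g x y' - g x y\<bar> < e"
    using uniformly_equicontinuous_of_periodic[OF eq per e] by blast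
  obtain Y and \<psi> :: "real ^ 'n \<Rightarrow> complex ^ 'n \<Rightarrow> real" where Y: "finite Y"
    "\<And>p. p \<in> Y \<Longrightarrow> continuous_on (torus_embedding ` cbox 0 1) (\<psi> p)"
    "\<And>p w. 0 \<le> \<psi> p w" "\<And>y. (\<Sum>p\<in>Y. \<psi> p (torus_embedding y)) = 1"
    "\<And>p y. \<psi> p (torus_embedding y) \<noteq> 0 \<Longrightarrow> \<exists>k\<in>integer_vectors. dist (y - k) p < \<delta>"
    using torus_partition_of_unity[OF \<delta>(1)] by metis
  have avg: "averages (\<lambda>x y. \<Sum>p\<in>Y. g x p * \<psi> p (torus_embedding y))"
    by (intro averages_sum Y averages_continuous_factor int)
  have "\<bar>g x y - (\<Sum>p\<in>Y. g x p * \<psi> p (torus_embedding y))\<bar> \<le> e * 1" if x: "x \<in> space M" for x y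
  proof -
    have near: "\<bar>g x y - g x p\<bar> * \<psi> p (torus_embedding y) \<le> e * \<psi> p (torus_embedding y)" for p
    proof (cases "\<psi> p (torus_embedding y) = 0")
      case False
      then obtain k where k: "k \<in> integer_vectors" "dist (y - k) p < \<delta>" using Y(5) by blast
      have "g x ((y - k) + k) = g x (y - k)" using per[OF x] k(1) unfolding periodic_def by blast
      then have "\<bar>g x y - g x p\<bar> < e" using \<delta>(2)[OF x k(2)] by simp
      then show ?thesis using Y(3) by (intro mult_right_mono) auto
    qed simp
    have "g x y - (\<Sum>p\<in>Y. g x p * \<psi> p (torus_embedding y)) =
        g x y * (\<Sum>p\<in>Y. \<psi> p (torus_embedding y)) - (\<Sum>p\<in>Y. g x p * \<psi> p (torus_embedding y))"
      by (simp add: Y(4))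
    also have "\<dots> = (\<Sum>p\<in>Y. (g x y - g x p) * \<psi> p (torus_embedding y))"
      by (simp add: sum_distrib_left sum_subtractf[symmetric] left_diff_distrib)
    also have "\<bar>\<dots>\<bar> \<le> (\<Sum>p\<in>Y. \<bar>(g x y - g x p) * \<psi> p (torus_embedding y)\<bar>)" by (rule sum_abs)
    also have "\<dots> = (\<Sum>p\<in>Y. \<bar>g x y - g x p\<bar> * \<psi> p (torus_embedding y))"
      using Y(3) by (simp add: abs_mult)
    also have "\<dots> \<le> (\<Sum>p\<in>Y. e * \<psi> p (torus_embedding y))" by (rule sum_mono[OF near])
    also have "\<dots> = e" by (simp add: sum_distrib_left[symmetric] Y(4))
    finally show ?thesis by simp
  qed
  then show "\<exists>b. averages b \<and> (\<forall>x\<in>space M. \<forall>y. \<bar>g x y - b x y\<bar> \<le> e * 1)"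
    using avg by blast
qed simp

end

section \<open>Sections of a function that is measurable on the completed product\<close>

lemma (in complete_measure) borel_measurable_cong_AE:
  fixes f g :: "'a \<Rightarrow> real"
  assumes f: "f \<in> borel_measurable M" and ae: "AE x in M. f x = g x"
  shows "g \<in> borel_measurable M"
proof (rule measurableI)
  fix A :: "real set" assume A: "A \<in> sets borel"
  show "g -` A \<inter> space M \<in> sets M"
  proof (rule in_sets_AE)
    show "f -` A \<inter> space M \<in> sets M" by (rule measurable_sets[OF f A])
    show "AE x in M. x \<in> f -` A \<inter> space M \<longleftrightarrow> x \<in> g -` A \<inter> space M"
      using ae by eventually_elim auto
  qed auto
qed simp

text \<open>Nonempty open sets have positive Lebesgue measure, so a property valid almost everywhere
  in the cell holds somewhere near each point of its closure.\<close>

lemma AE_torus_measure_dense: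
  fixes y :: "real ^ 'n"
  assumes ae: "AE t in torus_measure. P t" and \<eta>: "0 < \<eta>"
  shows "\<exists>k\<in>integer_vectors. \<exists>t. P t \<and> dist t (y - k) < \<eta>"
proof -
  let ?U = "{y :: real ^ 'n. \<forall>i. 0 \<le> y $ i \<and> y $ i < 1}"
  obtain k where k: "k \<in> integer_vectors" "\<And>i. 0 \<le> (y - k) $ i" "\<And>i. (y - k) $ i < 1"
    using ex_integer_translate[of y] by blast
  \<comment> \<open>\<open>y - k\<close> may lie on the boundary of the cell; the intersection with
    the open box is an open set inside the cell that still meets every ball around
    \<open>y - k\<close>.\<close>
  define V where "V = box 0 1 \<inter> ball (y - k) \<eta>"
  have "y - k \<in> cbox 0 1" using k by (simp add: mem_box_cart less_imp_le)
  moreover have "(1/2) *\<^sub>R (1 :: real ^ 'n) \<in> box 0 1" by (simp add: mem_box_cart)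
  ultimately have "y - k \<in> closure (box 0 1)" by (subst closure_box) auto
  then obtain t where "t \<in> box 0 1" "dist t (y - k) < \<eta>" using \<eta> unfolding closure_approachable by blast
  then have "t \<in> V" by (simp add: V_def dist_commute)
  then have "V \<noteq> {}" by blast
  moreover have "open V" unfolding V_def by (rule open_Int[OF open_box open_ball])
  ultimately have "\<not> negligible V" using open_not_negligible by blast
  have aeU: "AE t in lborel. t \<in> ?U \<longrightarrow> P t"
    using ae unfolding torus_measure_def by (subst (asm) AE_restrict_space_iff) auto
  have "V \<subseteq> ?U" by (auto simp: V_def mem_box_cart less_imp_le)
  have "\<exists>t\<in>V. P t"
  proof (rule ccontr)
    assume "\<not> (\<exists>t\<in>V. P t)"
    with aeU \<open>V \<subseteq> ?U\<close> have "AE t in lborel. t \<notin> V" by (auto elim!: eventually_mono)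
    then have "V \<in> null_sets lborel" using \<open>open V\<close> by (subst AE_iff_null_sets) auto
    then have "negligible V" by (simp add: negligible_iff_null_sets null_sets_completionI)
    with \<open>\<not> negligible V\<close> show False by blast
  qed
  then obtain t where "t \<in> V" "P t" by blast
  then show ?thesis using k(1) by (intro bexI[of _ k] exI[of _ t]) (auto simp: V_def dist_commute)
qed

text \<open>Fubini yields measurable bounded sections for almost every \<open>t\<close> only. Such
  \<open>t\<close> come arbitrarily close to any \<open>y\<close> modulo the integers, and
  equicontinuity makes the section at \<open>y\<close> a uniform limit of theirs.\<close>

lemma integrable_section:
  fixes g :: "real ^ 'm \<Rightarrow> real ^ 'n \<Rightarrow> real"
  assumes fin: "finite_measure M" and compl: "complete_measure M"
    and g: "(\<lambda>(z, y). g z y) \<in> L_infinity (completion (M \<Otimes>\<^sub>M torus_measure))"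
    and eq: "equicontinuous_family (space M) g" and per: "\<And>z. z \<in> space M \<Longrightarrow> periodic (g z)"
  shows "integrable M (\<lambda>z. g z y)"
proof -
  interpret M: finite_measure M by (rule fin)
  interpret C: complete_measure M by (rule compl)
  interpret T: finite_measure "torus_measure :: (real ^ 'n) measure" by (rule finite_measure_torus_measure)
  interpret P: pair_sigma_finite M "torus_measure :: (real ^ 'n) measure" ..
  let ?T = "torus_measure :: (real ^ 'n) measure"
  obtain B where gm: "(\<lambda>(z, y). g z y) \<in> borel_measurable (completion (M \<Otimes>\<^sub>M ?T))"
    and B: "AE p in completion (M \<Otimes>\<^sub>M ?T). \<bar>(\<lambda>(z, y). g z y) p\<bar> \<le> B"
    using g unfolding L_infinity_def by blast
  \<comment> \<open>A version of \<open>g\<close> that is measurable for the product before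
    completion, so that each of its sections is measurable.\<close>
  obtain f where f: "f \<in> borel_measurable (M \<Otimes>\<^sub>M ?T)" "AE p in M \<Otimes>\<^sub>M ?T. (\<lambda>(z, y). g z y) p = f p"
    using completion_ex_borel_measurable_real[OF gm] by blast
  have "AE p in M \<Otimes>\<^sub>M ?T. (\<lambda>(z, y). g z y) p = f p \<and> \<bar>(\<lambda>(z, y). g z y) p\<bar> \<le> B"
    using f(2) B by (simp add: AE_completion_iff)
  \<comment> \<open>The exceptional set is enlarged to a measurable one because exchanging the two
    almost-everywhere quantifiers requires measurability.\<close>
  then obtain N where N: "{p \<in> space (M \<Otimes>\<^sub>M ?T). \<not> ((\<lambda>(z, y). g z y) p = f p \<and> \<bar>(\<lambda>(z, y). g z y) p\<bar> \<le> B)} \<subseteq> N"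
      "emeasure (M \<Otimes>\<^sub>M ?T) N = 0" "N \<in> sets (M \<Otimes>\<^sub>M ?T)"
    by (rule AE_E)
  have "AE p in M \<Otimes>\<^sub>M ?T. p \<notin> N" using N by (intro AE_not_in) auto
  then have "AE z in M. AE t in ?T. (z, t) \<notin> N" by (rule P.AE_pair)
  moreover have "{p \<in> space (M \<Otimes>\<^sub>M ?T). (fst p, snd p) \<notin> N} = space (M \<Otimes>\<^sub>M ?T) - N" by auto
  then have "{p \<in> space (M \<Otimes>\<^sub>M ?T). (fst p, snd p) \<notin> N} \<in> sets (M \<Otimes>\<^sub>M ?T)" using N(3) by simp
  ultimately have swap: "AE t in ?T. AE z in M. (z, t) \<notin> N" using P.AE_commute[of "\<lambda>z t. (z, t) \<notin> N"] by blast
  define good where "good t \<longleftrightarrow> (\<lambda>z. g z t) \<in> borel_measurable M \<and> (AE z in M. \<bar>g z t\<bar> \<le> B)" for t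
  have "AE t in ?T. good t"
    using swap AE_space
  proof eventually_elim
    case (elim t)
    have ae: "AE z in M. f (z, t) = g z t \<and> \<bar>g z t\<bar> \<le> B"
      using elim(1) AE_space
    proof eventually_elim
      case (elim z)
      then have "(z, t) \<in> space (M \<Otimes>\<^sub>M ?T)" using \<open>t \<in> space ?T\<close> by (simp add: space_pair_measure)
      with elim N(1) show ?case by fastforce
    qed
    have "AE z in M. f (z, t) = g z t" and bound: "AE z in M. \<bar>g z t\<bar> \<le> B"
      using ae by (auto elim: eventually_mono)
    moreover have "(\<lambda>z. f (z, t)) \<in> borel_measurable M"
      by (rule measurable_compose[OF measurable_Pair2' f(1)]) (rule elim)
    \<comment> \<open>Completeness of \<open>M\<close> transfers measurability between two functions
      that agree only almost everywhere.\<close>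
    ultimately have "(\<lambda>z. g z t) \<in> borel_measurable M"
      using C.borel_measurable_cong_AE[of "\<lambda>z. f (z, t)" "\<lambda>z. g z t"] by blast
    with bound show ?case by (simp add: good_def)
  qed
  note dense = AE_torus_measure_dense[OF this]
  have "\<exists>t. good t \<and> (\<forall>z\<in>space M. \<bar>g z t - g z y\<bar> < inverse (real (Suc n)))" for n
  proof -
    obtain \<delta> where \<delta>: "\<delta> > 0" "\<And>z y y'. z \<in> space M \<Longrightarrow> dist y' y < \<delta> \<Longrightarrow> \<bar>g z y' - g z y\<bar> < inverse (real (Suc n))"
      using uniformly_equicontinuous_of_periodic[OF eq per, of "inverse (real (Suc n))"] by auto
    obtain k t where k: "k \<in> integer_vectors" and t: "good t" "dist t (y - k) < \<delta>" using dense[OF \<delta>(1)] by blast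
    have "\<bar>g z t - g z y\<bar> < inverse (real (Suc n))" if z: "z \<in> space M" for z
    proof -
      have "g z ((y - k) + k) = g z (y - k)" using per[OF z] k unfolding periodic_def by blast
      then show ?thesis using \<delta>(2)[OF z t(2)] by simp
    qed
    then show ?thesis using t(1) by blast
  qed
  then obtain t where t: "\<And>n. good (t n)" "\<And>n z. z \<in> space M \<Longrightarrow> \<bar>g z (t n) - g z y\<bar> < inverse (real (Suc n))"
    by metis
  have lim: "(\<lambda>n. g z (t n)) \<longlonglongrightarrow> g z y" if z: "z \<in> space M" for z
  proof -
    have "(\<lambda>n. g z (t n) - g z y) \<longlonglongrightarrow> 0"
    proof (rule Lim_null_comparison[OF _ LIMSEQ_inverse_real_of_nat])
      show "\<forall>\<^sub>F n in sequentially. norm (g z (t n) - g z y) \<le> inverse (real (Suc n))"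
        using t(2)[OF z] by (intro always_eventually allI less_imp_le) simp
    qed
    then show ?thesis by (simp add: LIM_zero_iff)
  qed
  show ?thesis
  proof (rule M.integrable_const_bound)
    show "(\<lambda>z. g z y) \<in> borel_measurable M"
      by (rule borel_measurable_LIMSEQ_real[OF lim]) (use t(1) in \<open>auto simp: good_def\<close>)
    \<comment> \<open>The points \<open>t n\<close> are countably many, so their exceptional null
      sets combine into one.\<close>
    have "AE z in M. \<forall>n. \<bar>g z (t n)\<bar> \<le> B" using t(1) by (simp add: AE_all_countable good_def)
    then show "AE z in M. norm (g z y) \<le> B"
      using AE_space
    proof eventually_elim
      case (elim z)
      have "(\<lambda>n. \<bar>g z (t n)\<bar>) \<longlonglongrightarrow> \<bar>g z y\<bar>" by (rule tendsto_rabs[OF lim[OF elim(2)]])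
      then show ?case using elim(1) by (auto intro: LIMSEQ_le_const2)
    qed
  qed
qed

theorem theorem1p1:
  fixes \<Gamma> :: "(real ^ 'n) set"
    and \<nu> :: "real ^ 'n \<Rightarrow> real ^ 'n"
    and g :: "real ^ 'n \<Rightarrow> real ^ 'n \<Rightarrow> real"
  assumes "CARD('n) \<ge> 2"
    and "compact \<Gamma>" and "C1_hypersurface \<Gamma>"
    and "unit_normal_mapping \<Gamma> \<nu>" and "IDDC \<Gamma> \<nu>"
    and "\<And>z. z \<in> \<Gamma> \<Longrightarrow> periodic (g z)"
    and "(\<lambda>(z, y). g z y) \<in> L_infinity (completion (surface_measure \<Gamma> \<Otimes>\<^sub>M torus_measure))"
    and "equicontinuous_family \<Gamma> g"
  shows "((\<lambda>\<epsilon>. LINT x|surface_measure \<Gamma>. g x (x /\<^sub>R \<epsilon>)) \<longlongrightarrow>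
          (LINT x|surface_measure \<Gamma>. LINT y|torus_measure. g x y)) (at 0)"
proof -
  have sp: "space (surface_measure \<Gamma>) = \<Gamma>" using assms(2) by (simp add: borel_compact)
  have fin: "finite_measure (surface_measure \<Gamma>)"
    by (rule finite_measure_surface_measure[OF assms(1-3)])
  interpret nonresonant_measure "surface_measure \<Gamma>"
  proof (intro nonresonant_measure.intro fin nonresonant_measure_axioms.intro)
    show "{x \<in> space (surface_measure \<Gamma>). k \<bullet> x \<in> N} \<in> null_sets (surface_measure \<Gamma>)"
      if "k \<in> integer_vectors" "k \<noteq> 0" "N \<in> null_sets lborel" for k N
      unfolding sp by (rule surface_measure_level_null[OF assms(2-5) that])
  qed (rule measurable_surface_measure)
  have "averages g"
  proof (rule averages_equicontinuous)
    show "integrable (surface_measure \<Gamma>) (\<lambda>x. g x y)" for y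
      by (rule integrable_section[OF fin complete_measure_surface_measure assms(7)])
        (use assms sp in auto)
  qed (use assms sp in auto)
  then show ?thesis by (simp add: averages_def)
qed

end
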